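(* For every sequence $(\alpha_i)_{i<\omega}$ of ordinals, the ordinal $\#^{S}_{i<\omega}\alpha_i$ is the largest mixed sum of $(\alpha_i)_{i<\omega}$ which is order respecting modulo finite. That is, $\#^{S}_{i<\omega}\alpha_i$ can be realized as an order respecting modulo finite mixed sum of $(\alpha_i)_{i<\omega}$, and every ordinal $\gamma$ which can be realized as an order respecting modulo finite mixed sum of $(\alpha_i)_{i<\omega}$ satisfies $\gamma\le\#^{S}_{i<\omega}\alpha_i$.
   Context: Notation. $+$ is the usual ordinal sum, $\#$ (binary or finitary) is the Hessenberg natural sum of ordinals, and $\otimes$ is the natural product of ordinals: $\omega^{\xi}\otimes\omega^{\rho}=\omega^{\xi\#\rho}$, extended to arbitrary ordinals in normal form by distributivity over $\#$, with $\alpha\otimes 0=0\otimes\alpha=0$. The ordinal $0$ is neither limit nor successor. Every nonzero ordinal $\zeta$ is uniquely written in (additive) normal form $\zeta=\omega^{\xi_s}+\dots+\omega^{\xi_1}+\omega^{\xi_0}$ with $\xi_s\ge\dots\ge\xi_0$; put $\hat\zeta=\omega^{\xi_s}+\dots+\omega^{\xi_1}$ (last summand removed; $\hat\zeta=0$ if there is only one summand). For a sequence $\bm\alpha=(\alpha_i)_{i<\omega}$ of ordinals, let $\varepsilon_{\bm\alpha}$ be the least ordinal $\varepsilon$ such that $\{i<\omega:\varepsilon\le\alpha_i\}$ is finite, and let $\zeta_{\bm\alpha}$ be the least ordinal $\zeta$ such that $\{i<\omega:\zeta<\alpha_i\}$ is finite. The element $\alpha_i$ (for the index $i$) is e-special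 if $\alpha_i\ge\varepsilon_{\bm\alpha}$. One always has $\zeta_{\bm\alpha}\le\varepsilon_{\bm\alpha}$. Definition of $\#^{S}$. Let $i_1,\dots,i_h$ enumerate the finite (possibly empty) set of indices of e-special elements of $\bm\alpha$. Let $\alpha_{i_p}^{\heartsuit}$ be the unique ordinal with $\zeta_{\bm\alpha}+\alpha_{i_p}^{\heartsuit}=\alpha_{i_p}$ and, if $\zeta_{\bm\alpha}>0$, let $\alpha_{i_p}^{\diamondsuit}$ be the unique ordinal with $\hat\zeta_{\bm\alpha}+\alpha_{i_p}^{\diamondsuit}=\alpha_{i_p}$. If $\zeta_{\bm\alpha}>0$, let $\omega^{\xi_0}$ be the last summand in the normal form of $\zeta_{\bm\alpha}$. (S1) If $\zeta_{\bm\alpha}>0$, $\xi_0$ is a limit ordinal, and only finitely many elements of $\bm\alpha$ are $\ge\zeta_{\bm\alpha}$ (i.e. $\zeta_{\bm\alpha}=\varepsilon_{\bm\alpha}$), then $\#^{S}_{i<\omega}\alpha_i=(\hat\zeta_{\bm\alpha}\otimes\omega)\,\#\,\omega^{\xi_0}\,\#\,\alpha_{i_1}^{\diamondsuit}\,\#\cdots\#\,\alpha_{i_h}^{\diamondsuit}$. (S2) Otherwise (including the case $\zeta_{\bm\alpha}=0$), $\#^{S}_{i<\omega}\alpha_i=(\zeta_{\bm\alpha}\otimes\omega)\,\#\,\alpha_{i_1}^{\heartsuit}\,\#\cdots\#\,\alpha_{i_h}^{\heartsuit}$. Mixed sums. An ordinal $\gamma$ is a mixed sum of a family $(\alpha_i)_{i\in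 I}$ of ordinals, realized by $(A_i)_{i\in I}$, if the $A_i$ are pairwise disjoint subsets of $\gamma$ with $\bigcup_{i\in I}A_i=\gamma$ and each $A_i$, with the order induced by $\gamma$, has order-type $\alpha_i$. Let $h_i:A_i\to\alpha_i$ be the order-preserving bijection. The mixed sum (realization) is order respecting modulo finite if, for every $i\in I$ and every $\eta\in A_i$, the set $\{j\in I:\text{there is }\theta\in A_j\text{ such that }\theta<\eta\text{ and }h_j(\theta)\ge h_i(\eta)\}$ is finite. *)

theory Defs
  imports Main "HOL-Library.Disjoint_Sets"
begin

unbundle cardinal_syntax

section \<open>Ordinals\<close>

text \<open>
  HOL has no type of all ordinals. For a type \<open>'a\<close>, the type \<open>'a ordinal\<close> consists of the
  order types of all well-orders on subsets of \<open>'a + nat\<close>; that is, of the ordinals below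
  \<open>\<kappa>\<^sup>+\<close>, where \<open>\<kappa>\<close> is the (infinite) cardinality of \<open>'a + nat\<close>. Every set of ordinals is
  contained in \<open>'a ordinal\<close> for a sufficiently large \<open>'a\<close>, so quantification over all ordinals is
  polymorphism in \<open>'a\<close>. As \<open>\<kappa>\<^sup>+\<close> is regular and uncountable, suprema of countable sets exist in
  \<open>'a ordinal\<close> and it is closed under the operations below.
\<close>

quotient_type 'a ordinal = "('a + nat) rel" / partial: "\<lambda>r s. r =o s"
proof (rule part_equivpI)
  have "Well_order ({} :: ('a + nat) rel)"
    by (simp add: Field_def)
  then show "\<exists>r :: ('a + nat) rel. r =o r"
    using ordIso_reflexive by blast
  show "symp (\<lambda>r s :: ('a + nat) rel. r =o s)"
    by (auto intro: sympI ordIso_symmetric)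
  show "transp (\<lambda>r s :: ('a + nat) rel. r =o s)"
    by (auto intro: transpI ordIso_transitive)
qed

lemma Well_order_rep_ordinal: "Well_order (rep_ordinal x)"
  using Quotient3_rep_reflp[OF Quotient3_ordinal] unfolding ordIso_def by blast

instantiation ordinal :: (type) linorder
begin

lift_definition less_eq_ordinal :: "'a ordinal \<Rightarrow> 'a ordinal \<Rightarrow> bool" is "\<lambda>r s. r \<le>o s"
  by (meson ordIso_ordLeq_trans ordIso_symmetric ordLeq_ordIso_trans)

lift_definition less_ordinal :: "'a ordinal \<Rightarrow> 'a ordinal \<Rightarrow> bool" is "\<lambda>r s. r <o s"
  by (meson ordIso_ordLess_trans ordIso_symmetric ordLess_ordIso_trans)

instance
proof
  fix x y z :: "'a ordinal"
  show "x < y \<longleftrightarrow> x \<le> y \<and> \<not> y \<le> x"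
  proof transfer
    fix r s :: "('a + nat) rel"
    assume "r =o r" "s =o s"
    then have "Well_order r" "Well_order s"
      by (simp_all add: ordIso_def)
    then have "r <o s \<longleftrightarrow> \<not> s \<le>o r"
      by (simp add: not_ordLeq_iff_ordLess)
    then show "r <o s \<longleftrightarrow> r \<le>o s \<and> \<not> s \<le>o r"
      using ordLess_imp_ordLeq by blast
  qed
  show "x \<le> x"
    by transfer (rule ordIso_imp_ordLeq)
  show "x \<le> y \<Longrightarrow> y \<le> z \<Longrightarrow> x \<le> z"
    by transfer (rule ordLeq_transitive)
  show "x \<le> y \<Longrightarrow> y \<le> x \<Longrightarrow> x = y"
    by transfer (simp add: ordIso_iff_ordLeq)
  show "x \<le> y \<or> y \<le> x"
    by transfer (simp add: ordLeq_total ordIso_def)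
qed

end

lemma less_ordinal_rep: "x < y \<longleftrightarrow> rep_ordinal x <o rep_ordinal y"
  unfolding less_ordinal_def by simp

lemma wf_less_ordinal: "wf {(x :: 'a ordinal, y). x < y}"
proof -
  have "{(x :: 'a ordinal, y). x < y} = inv_image ordLess rep_ordinal"
    by (auto simp: inv_image_def less_ordinal_rep)
  then show ?thesis
    by (simp add: wf_inv_image wf_ordLess)
qed

instance ordinal :: (type) wellorder
proof
  fix P :: "'a ordinal \<Rightarrow> bool" and a :: "'a ordinal"
  assume step: "\<And>x. (\<And>y. y < x \<Longrightarrow> P y) \<Longrightarrow> P x"
  show "P a"
    by (rule wf_induct_rule[OF wf_less_ordinal]) (auto intro: step)
qed

lemma rep_abs_ordinal: "Well_order r \<Longrightarrow> rep_ordinal (abs_ordinal r) =o r"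
  using Quotient3_rep_abs[OF Quotient3_ordinal] ordIso_reflexive by blast

text \<open>Every well-order, on any type, whose field is not too large has its order type in
  \<open>'a ordinal\<close>. In particular, so does every countable mixed sum of elements of \<open>'a ordinal\<close>.\<close>

lemma ex_ordinal_of_Well_order:
  fixes r :: "'b rel"
  assumes r: "Well_order r" and le: "|Field r| \<le>o |UNIV :: ('a + nat) set|"
  shows "\<exists>x :: 'a ordinal. rep_ordinal x =o r"
proof -
  obtain f :: "'b \<Rightarrow> 'a + nat" where f: "inj_on f (Field r)"
    using iffD2[OF card_of_ordLeq le] by blast
  have *: "r =o dir_image r f"
    using r f by (rule dir_image_ordIso)
  then have "rep_ordinal (abs_ordinal (dir_image r f)) =o dir_image r f"
    by (intro rep_abs_ordinal) (simp add: ordIso_def)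
  then show ?thesis
    by (intro exI) (rule ordIso_transitive[OF _ ordIso_symmetric[OF *]])
qed

lemma ex_ordinal_of_countable_mixed_sum:
  fixes r :: "'b rel" and \<alpha> :: "nat \<Rightarrow> 'a ordinal"
  assumes r: "Well_order r" and A: "Field r = (\<Union>i. A i)"
    and iso: "\<And>i. Restr r (A i) =o rep_ordinal (\<alpha> i)"
  shows "\<exists>x :: 'a ordinal. rep_ordinal x =o r"
proof (rule ex_ordinal_of_Well_order[OF r])
  have inf: "\<not> finite (UNIV :: ('a + nat) set)"
    by (simp add: finite_Plus_UNIV_iff)
  have "|A i| \<le>o |UNIV :: ('a + nat) set|" for i
  proof -
    have "Refl r"
      using r by (simp add: order_on_defs)
    then have "Field (Restr r (A i)) = A i"
      using A by (subst Refl_Field_Restr) auto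
    then have "|A i| \<le>o |Field (rep_ordinal (\<alpha> i))|"
      using card_of_mono2[OF ordIso_imp_ordLeq[OF iso[of i]]] by simp
    then show ?thesis
      by (rule ordLeq_transitive[OF _ card_of_mono1[OF subset_UNIV]])
  qed
  moreover have "|UNIV :: nat set| \<le>o |UNIV :: ('a + nat) set|"
    by (rule iffD1[OF infinite_iff_card_of_nat inf])
  ultimately show "|Field r| \<le>o |UNIV :: ('a + nat) set|"
    unfolding A by (intro card_of_UNION_ordLeq_infinite[OF inf]) auto
qed

text \<open>As usual for ordinals, \<open>x\<close> is the order type of the set of its predecessors, so that
  \<open>{..<x}\<close> plays the role of the von Neumann ordinal \<open>x\<close>.\<close>

lemma lessThan_ordIso_rep_ordinal: "rep_ordinal x =o {(y, z). y \<le> z \<and> z < x}"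
proof -
  define R where "R = rep_ordinal x"
  define S where "S = {(y, z). y \<le> z \<and> z < x}"
  define f where "f a = abs_ordinal (Restr R (underS R a))" for a
  have R: "Well_order R"
    by (simp add: R_def Well_order_rep_ordinal)
  then have WR: "Well_order (Restr R B)" for B
    by (rule Well_order_Restr)
  have FS: "Field S = {..<x}"
    by (auto simp: S_def Field_def)
  have S: "Well_order S"
    unfolding well_order_on_def linear_order_on_def partial_order_on_def preorder_on_def FS
  proof (intro conjI)
    show "wf (S - Id)"
      by (rule wf_subset[OF wf_less_ordinal]) (auto simp: S_def)
    show "S \<subseteq> {..<x} \<times> {..<x}" "refl_on {..<x} S"
      by (auto simp: S_def refl_on_def)
    show "trans S" "antisym S" "total_on {..<x} S"
      by (auto simp: S_def trans_def antisym_def total_on_def)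
  qed
  have rep_f: "rep_ordinal (f a) =o Restr R (underS R a)" for a
    unfolding f_def by (rule rep_abs_ordinal[OF WR])
  have f_less: "f a < f b" if "(a, b) \<in> R" "a \<noteq> b" for a b
  proof -
    have "trans R" "antisym R"
      using R by (simp_all add: order_on_defs)
    have "underS R a \<subseteq> underS R b"
    proof
      fix c assume "c \<in> underS R a"
      then have c: "c \<noteq> a" "(c, a) \<in> R"
        by (auto simp: underS_def)
      then have "(c, b) \<in> R"
        using transD[OF \<open>trans R\<close>] that by metis
      moreover have "c \<noteq> b"
        using antisymD[OF \<open>antisym R\<close>] that c by metis
      ultimately show "c \<in> underS R b"
        by (simp add: underS_def)
    qed
    moreover have "a \<in> underS R b" "a \<notin> underS R a"
      using that by (auto simp: underS_def)
    ultimately have "underS R a \<subset> underS R b"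
      by blast
    moreover have "wo_rel R"
      using R by (simp add: wo_rel_def)
    ultimately have "Restr R (underS R a) <o Restr R (underS R b)"
      using ofilter_subset_ordLess[OF R] wo_rel.underS_ofilter by metis
    then show ?thesis
      using ordLess_ordIso_trans[OF ordIso_ordLess_trans[OF rep_f] ordIso_symmetric[OF rep_f]]
      by (simp add: less_ordinal_rep)
  qed
  have f_eq: "a = b \<or> f a < f b \<or> f b < f a" if "a \<in> Field R" "b \<in> Field R" for a b
  proof -
    have "a = b \<or> (a, b) \<in> R \<or> (b, a) \<in> R"
      using that R unfolding order_on_defs total_on_def by metis
    then show ?thesis
      using f_less by metis
  qed
  have "f a < x" if "a \<in> Field R" for a
    using ordIso_ordLess_trans[OF rep_f underS_Restr_ordLess[OF R]] that
    by (auto simp: less_ordinal_rep R_def)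
  moreover have "\<exists>a \<in> Field R. y = f a" if "y < x" for y
  proof -
    have "rep_ordinal y <o R"
      using that by (simp add: less_ordinal_rep R_def)
    then obtain a where "a \<in> Field R" and a: "rep_ordinal y =o Restr R (underS R a)"
      using ordLess_iff_ordIso_Restr[OF R Well_order_rep_ordinal[of y]] by blast
    have "rep_ordinal y =o rep_ordinal (f a)"
      by (rule ordIso_transitive[OF a ordIso_symmetric[OF rep_f]])
    then have "y = f a"
      by (simp add: Quotient3_rel_rep[OF Quotient3_ordinal])
    with \<open>a \<in> Field R\<close> show ?thesis by blast
  qed
  moreover have "inj_on f (Field R)"
    using f_eq by (metis inj_onI less_irrefl)
  ultimately have "bij_betw f (Field R) (Field S)"
    unfolding FS bij_betw_def by auto
  moreover have "(a, b) \<in> R \<longleftrightarrow> (f a, f b) \<in> S" if "a \<in> Field R" "b \<in> Field R" for a b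
  proof -
    have "(a, a) \<in> R" "(a, b) \<in> R \<or> (b, a) \<in> R"
      using that R unfolding order_on_defs refl_on_def total_on_def by metis+
    moreover have "f b < x"
      using that \<open>\<And>a. a \<in> Field R \<Longrightarrow> f a < x\<close> by blast
    ultimately show ?thesis
      using f_less[of a b] f_less[of b a] by (cases "a = b") (auto simp: S_def)
  qed
  ultimately have "iso R S f"
    unfolding iso_iff2 by (intro conjI ballI)
  with R S have "R =o S"
    unfolding ordIso_def by (intro CollectI case_prodI conjI exI[of _ f])
  then show ?thesis
    unfolding R_def S_def .
qed

unbundle no cardinal_syntax


section \<open>Ordinal arithmetic\<close>

text \<open>The recursions defining \<open>x + y\<close>, \<open>x * y\<close> and \<open>\<omega>\<^sup>x\<close> merge the usual zero, successor and limit clauses into one.\<close>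

function oadd :: "'a ordinal \<Rightarrow> 'a ordinal \<Rightarrow> 'a ordinal" where
  "oadd x y = (LEAST z. x \<le> z \<and> (\<forall>y' \<in> {..<y}. oadd x y' < z))"
  by pat_completeness auto
termination
  by (relation "inv_image {(x, y). x < y} snd") (auto simp: wf_less_ordinal)

declare oadd.simps [simp del]

function omult :: "'a ordinal \<Rightarrow> 'a ordinal \<Rightarrow> 'a ordinal" where
  "omult x y = (LEAST z. \<forall>y' \<in> {..<y}. oadd (omult x y') x \<le> z)"
  by pat_completeness auto
termination
  by (relation "inv_image {(x, y). x < y} snd") (auto simp: wf_less_ordinal)

declare omult.simps [simp del]

instantiation ordinal :: (type) "{zero, one, plus, times}"
begin

definition "0 = (LEAST x :: 'a ordinal. True)"
definition "1 = (LEAST x :: 'a ordinal. 0 < x)"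
definition "x + y = oadd x y" for x y :: "'a ordinal"
definition "x * y = omult x y" for x y :: "'a ordinal"

instance ..

end

definition succ_ordinal :: "'a ordinal \<Rightarrow> 'a ordinal" where
  "succ_ordinal x = (LEAST y. x < y)"

definition limit_ordinal :: "'a ordinal \<Rightarrow> bool" where
  "limit_ordinal x \<longleftrightarrow> x \<noteq> 0 \<and> (\<forall>y. x \<noteq> succ_ordinal y)"

definition omega :: "'a ordinal" ("\<omega>") where
  "\<omega> = (LEAST x. limit_ordinal x)"

function omega_power :: "'a ordinal \<Rightarrow> 'a ordinal" where
  "omega_power x = (LEAST z. 1 \<le> z \<and> (\<forall>x' \<in> {..<x}. omega_power x' * \<omega> \<le> z))"
  by pat_completeness auto
termination
  by (relation "{(x, y). x < y}") (auto simp: wf_less_ordinal)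

declare omega_power.simps [simp del]


section \<open>Normal forms and natural operations\<close>

text \<open>A normal form is represented by its list of exponents, \<open>[\<xi>\<^sub>s, \<dots>, \<xi>\<^sub>1, \<xi>\<^sub>0]\<close>; the empty
  list represents \<open>0\<close>.\<close>

definition nf_value :: "'a ordinal list \<Rightarrow> 'a ordinal" where
  "nf_value xs = foldr (\<lambda>x z. omega_power x + z) xs 0"

definition normal_form :: "'a ordinal \<Rightarrow> 'a ordinal list" where
  "normal_form z = (THE xs. sorted_wrt (\<ge>) xs \<and> nf_value xs = z)"

definition hat :: "'a ordinal \<Rightarrow> 'a ordinal" where
  "hat z = nf_value (butlast (normal_form z))"

definition last_exp :: "'a ordinal \<Rightarrow> 'a ordinal" where
  "last_exp z = last (normal_form z)"

definition nat_sum :: "'a ordinal \<Rightarrow> 'a ordinal \<Rightarrow> 'a ordinal" (infixl "\<sharp>" 65) where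
  "x \<sharp> y = nf_value (rev (sort (normal_form x @ normal_form y)))"

definition nat_sum_list :: "'a ordinal list \<Rightarrow> 'a ordinal" where
  "nat_sum_list xs = foldr (\<sharp>) xs 0"

definition nat_prod :: "'a ordinal \<Rightarrow> 'a ordinal \<Rightarrow> 'a ordinal" (infixl "\<otimes>" 70) where
  "x \<otimes> y = nat_sum_list [omega_power (a \<sharp> b). a \<leftarrow> normal_form x, b \<leftarrow> normal_form y]"


section \<open>The infinitary sum\<close>

definition eps_seq :: "(nat \<Rightarrow> 'a ordinal) \<Rightarrow> 'a ordinal" where
  "eps_seq \<alpha> = (LEAST \<epsilon>. finite {i. \<epsilon> \<le> \<alpha> i})"

definition zeta_seq :: "(nat \<Rightarrow> 'a ordinal) \<Rightarrow> 'a ordinal" where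
  "zeta_seq \<alpha> = (LEAST \<zeta>. finite {i. \<zeta> < \<alpha> i})"

definition e_special :: "(nat \<Rightarrow> 'a ordinal) \<Rightarrow> nat set" where
  "e_special \<alpha> = {i. eps_seq \<alpha> \<le> \<alpha> i}"

definition heart :: "(nat \<Rightarrow> 'a ordinal) \<Rightarrow> nat \<Rightarrow> 'a ordinal" where
  "heart \<alpha> i = (THE \<delta>. zeta_seq \<alpha> + \<delta> = \<alpha> i)"

definition diamond :: "(nat \<Rightarrow> 'a ordinal) \<Rightarrow> nat \<Rightarrow> 'a ordinal" where
  "diamond \<alpha> i = (THE \<delta>. hat (zeta_seq \<alpha>) + \<delta> = \<alpha> i)"

text \<open>In the condition of the first case, \<open>finite {i. \<zeta> \<le> \<alpha> i}\<close> means \<open>zeta_seq \<alpha> = eps_seq \<alpha>\<close>;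
  \<open>last_exp \<zeta>\<close> and \<open>diamond \<alpha>\<close> are meaningful only for \<open>\<zeta> > 0\<close>.\<close>

definition nat_sum_S :: "(nat \<Rightarrow> 'a ordinal) \<Rightarrow> 'a ordinal" where
  "nat_sum_S \<alpha> =
    (let \<zeta> = zeta_seq \<alpha>; is = sorted_list_of_set (e_special \<alpha>)
     in if \<zeta> > 0 \<and> limit_ordinal (last_exp \<zeta>) \<and> finite {i. \<zeta> \<le> \<alpha> i}
        then (hat \<zeta> \<otimes> \<omega>) \<sharp> omega_power (last_exp \<zeta>) \<sharp> nat_sum_list (map (diamond \<alpha>) is)
        else (\<zeta> \<otimes> \<omega>) \<sharp> nat_sum_list (map (heart \<alpha>) is))"


section \<open>Mixed sums\<close>

definition order_iso_onto :: "('a ordinal \<Rightarrow> 'a ordinal) \<Rightarrow> 'a ordinal set \<Rightarrow> 'a ordinal \<Rightarrow> bool" where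
  "order_iso_onto h A x \<longleftrightarrow> bij_betw h A {..<x} \<and> strict_mono_on A h"

definition realizes_mixed_sum ::
    "'a ordinal \<Rightarrow> ('i \<Rightarrow> 'a ordinal) \<Rightarrow> ('i \<Rightarrow> 'a ordinal set) \<Rightarrow> bool" where
  "realizes_mixed_sum \<gamma> \<alpha> A \<longleftrightarrow>
     disjoint_family A \<and> (\<Union>i. A i) = {..<\<gamma>} \<and> (\<forall>i. \<exists>h. order_iso_onto h (A i) (\<alpha> i))"

text \<open>An order isomorphism from \<open>A\<close> onto \<open>{..<x}\<close> is unique on \<open>A\<close>, and only its values on \<open>A\<close>
  are used below.\<close>

definition the_iso :: "'a ordinal set \<Rightarrow> 'a ordinal \<Rightarrow> 'a ordinal \<Rightarrow> 'a ordinal" where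
  "the_iso A x = (SOME h. order_iso_onto h A x)"

definition order_respecting_mod_finite ::
    "('i \<Rightarrow> 'a ordinal) \<Rightarrow> ('i \<Rightarrow> 'a ordinal set) \<Rightarrow> bool" where
  "order_respecting_mod_finite \<alpha> A \<longleftrightarrow>
     (let h = (\<lambda>i. the_iso (A i) (\<alpha> i))
      in \<forall>i. \<forall>\<eta> \<in> A i. finite {j. \<exists>\<theta> \<in> A j. \<theta> < \<eta> \<and> h i \<eta> \<le> h j \<theta>})"

definition orf_mixed_sum :: "'a ordinal \<Rightarrow> ('i \<Rightarrow> 'a ordinal) \<Rightarrow> bool" where
  "orf_mixed_sum \<gamma> \<alpha> \<longleftrightarrow>
     (\<exists>A. realizes_mixed_sum \<gamma> \<alpha> A \<and> order_respecting_mod_finite \<alpha> A)"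

end

theory Submission
  imports Defs "HOL-Library.Multiset_Order" "HOL-Library.Infinite_Set"
begin

text \<open>
  An ordinal is determined by the multiset of exponents of its Cantor normal form, ordinals are
  ordered like these multisets, and the natural sum becomes the union of multisets.

  Upper bound: cut a realization of \<open>\<gamma>\<close> at a place \<open>\<delta> < \<gamma>\<close>, the \<open>x\<close>-th element of \<open>A i\<close>. This
  realizes \<open>\<delta>\<close> as a mixed sum of a smaller sequence \<open>\<alpha>'\<close> with \<open>\<alpha>' i = x\<close>, and order respecting
  modulo finite says that only finitely many \<open>\<alpha>' j\<close> exceed \<open>x\<close>. For such an \<open>\<alpha>'\<close> the infinitary sum is strictly smaller than for \<open>\<alpha>\<close>, so \<open>\<gamma>\<close> is bounded by induction.

  Realization: by the upper bound, it suffices to realize some ordinal that is not smaller than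
  the infinitary sum. By induction on the sum, shorten \<open>\<alpha>\<close> so that the sum loses exactly its last
  term \<open>\<omega>\<^sup>e\<close>, and extend a realization for the shortened sequence by at least \<open>\<omega>\<^sup>e\<close> places.
\<close>

text \<open>The split into (S1) and (S2) is dictated by what cuts can reach. Write \<zeta> = h +
  omega^e with h its hat. A cut can have as its own \<zeta> any h + s with s < omega^e, and its sum
  then contains s \<otimes> \<omega>. If e is a limit, the exponents of s \<otimes> \<omega> are
  still below e, so a single omega^e dominates all of them; when only finitely many terms reach
  \<zeta>, nothing more can be gained, and this is (S1). If e = u + 1, then s = omega^u * n already
  yields n copies of omega^e, for every n, and together these amount to omega^(e+1). The same
  happens for any e if infinitely many terms reach \<zeta>, since each of them supplies omega^e. For
  e = 0 this is automatic, because exceeding h and reaching h + 1 are the same.\<close>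

unbundle cardinal_syntax

section \<open>Suprema, successors and \<open>\<omega>\<close>\<close>

lemma card_lessThan_ordinal: "|{..<x :: 'a ordinal}| \<le>o |UNIV :: ('a + nat) set|"
proof -
  have "Field {(y, z). y \<le> z \<and> z < x} = {..<x}"
    by (auto simp: Field_def)
  moreover have "|Field {(y, z). y \<le> z \<and> z < x}| \<le>o |Field (rep_ordinal x)|"
    by (rule card_of_mono2[OF ordIso_imp_ordLeq[OF ordIso_symmetric[OF lessThan_ordIso_rep_ordinal]]])
  ultimately have "|{..<x}| \<le>o |Field (rep_ordinal x)|"
    by (simp only:)
  then show ?thesis
    by (rule ordLeq_transitive[OF _ card_of_mono1[OF subset_UNIV]])
qed

text \<open>Burali-Forti: if the type were small, its own order would have an order type x inside
  it, yet x is the order type of the proper initial segment below x.\<close>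

lemma not_card_UNIV_ordinal: "\<not> |UNIV :: 'a ordinal set| \<le>o |UNIV :: ('a + nat) set|"
proof
  assume small: "|UNIV :: 'a ordinal set| \<le>o |UNIV :: ('a + nat) set|"
  define R where "R = {(y :: 'a ordinal, z). y \<le> z}"
  have F: "Field R = UNIV"
    by (auto simp: R_def Field_def)
  have R: "Well_order R"
    unfolding well_order_on_def linear_order_on_def partial_order_on_def preorder_on_def F
  proof (intro conjI)
    show "wf (R - Id)"
      by (rule wf_subset[OF wf_less_ordinal]) (auto simp: R_def)
    show "R \<subseteq> UNIV \<times> UNIV" "refl_on UNIV R" "trans R" "antisym R" "total_on UNIV R"
      by (auto simp: R_def refl_on_def trans_def antisym_def total_on_def)
  qed
  obtain x :: "'a ordinal" where x: "rep_ordinal x =o R"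
    using ex_ordinal_of_Well_order[OF R] small F by auto
  have "Restr R (underS R x) = {(y, z). y \<le> z \<and> z < x}"
    by (auto simp: R_def underS_def)
  moreover have "Restr R (underS R x) <o R"
    using underS_Restr_ordLess[OF R] F by blast
  ultimately have "rep_ordinal x <o R"
    using ordIso_ordLess_trans[OF lessThan_ordIso_rep_ordinal[of x]] by simp
  with x show False
    using not_ordLess_ordIso by blast
qed

text \<open>Regularity of the successor cardinal: without a strict upper bound, the segments
  \<open>insert (f i) {..<f i}\<close> would cover the whole type by few small sets. This is why the
  LEAST in the arithmetic recursions is attained.\<close>

lemma ex_greater_small:
  fixes f :: "'i \<Rightarrow> 'a ordinal"
  assumes "|I| \<le>o |UNIV :: ('a + nat) set|"
  shows "\<exists>z. \<forall>i \<in> I. f i < z"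
proof (rule ccontr)
  assume "\<not> ?thesis"
  then have "\<forall>z. \<exists>i \<in> I. z \<le> f i"
    by (simp add: not_less)
  then have "UNIV = (\<Union>i \<in> I. insert (f i) {..<f i})"
    by (auto simp: order.order_iff_strict)
  moreover have "|insert (f i) {..<f i}| \<le>o |UNIV :: ('a + nat) set|" for i
  proof -
    have "|{f i} \<union> {..<f i}| \<le>o |UNIV :: ('a + nat) set|"
      by (rule card_of_Un_ordLeq_infinite_Field)
        (simp_all add: Field_card_of finite_Plus_UNIV_iff card_of_singl_ordLeq
          card_lessThan_ordinal card_of_card_order_on)
    then show ?thesis
      by simp
  qed
  ultimately have "|UNIV :: 'a ordinal set| \<le>o |UNIV :: ('a + nat) set|"
    using card_of_UNION_ordLeq_infinite[OF _ assms, of "\<lambda>i. insert (f i) {..<f i}"]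
    by (simp add: finite_Plus_UNIV_iff)
  then show False
    using not_card_UNIV_ordinal by blast
qed

lemma ex_greater_lessThan: "\<exists>z :: 'a ordinal. \<forall>y < x :: 'a ordinal. f y < z"
  using ex_greater_small[OF card_lessThan_ordinal] by (metis lessThan_iff)

lemma ex_greater_nat: "\<exists>z :: 'a ordinal. \<forall>n :: nat. f n < z"
proof -
  have "|UNIV :: nat set| \<le>o |UNIV :: ('a + nat) set|"
    by (rule iffD1[OF infinite_iff_card_of_nat]) (simp add: finite_Plus_UNIV_iff)
  from ex_greater_small[OF this] show ?thesis
    by simp
qed

unbundle no cardinal_syntax

text \<open>An equation between segments carries both halves of a supremum: every \<open>f n\<close>
  is at most z, and every y < z is below some \<open>f n\<close>.\<close>

lemma sup_nat_ordinal:
  fixes f :: "nat \<Rightarrow> 'a ordinal"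
  obtains z where "{..<z} = (\<Union>n. {..<f n})"
proof
  let ?z = "LEAST z. \<forall>n. f n \<le> z"
  have "\<exists>z. \<forall>n. f n \<le> z"
    using ex_greater_nat[of f] less_imp_le by blast
  then have ge: "f n \<le> ?z" for n
    by (rule LeastI2_ex) simp
  have "\<exists>n. y < f n" if "y < ?z" for y
    using not_less_Least[OF that] by (auto simp: not_le)
  then show "{..<?z} = (\<Union>n. {..<f n})"
    using ge by (auto intro: less_le_trans)
qed

section \<open>Zero, successors, limit ordinals and \<omega>\<close>

lemma zero_le_ordinal [simp]: "0 \<le> (x :: 'a ordinal)"
  unfolding zero_ordinal_def by (rule Least_le) simp

lemma not_less_zero_ordinal [simp]: "\<not> x < (0 :: 'a ordinal)"
  by (simp add: not_less)

lemma le_zero_ordinal_iff [simp]: "x \<le> 0 \<longleftrightarrow> x = (0 :: 'a ordinal)"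
  by (auto intro: antisym)

lemma zero_less_ordinal_iff: "0 < x \<longleftrightarrow> x \<noteq> (0 :: 'a ordinal)"
  by (metis le_zero_ordinal_iff not_less)

lemma less_succ_ordinal_iff [simp]: "x < succ_ordinal y \<longleftrightarrow> x \<le> y"
proof -
  have "\<exists>z. y < z"
    using ex_greater_nat[of "\<lambda>_. y"] by blast
  then have "y < succ_ordinal y"
    unfolding succ_ordinal_def by (rule LeastI_ex)
  then show ?thesis
    unfolding succ_ordinal_def by (meson Least_le not_less order.strict_trans2 order.strict_trans1 leI)
qed

lemma succ_ordinal_le_iff [simp]: "succ_ordinal x \<le> y \<longleftrightarrow> x < y"
  by (meson less_succ_ordinal_iff not_less)

lemma succ_ordinal_less_iff [simp]: "succ_ordinal x < succ_ordinal y \<longleftrightarrow> x < y"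
  by (meson less_succ_ordinal_iff succ_ordinal_le_iff not_less)

lemma less_succ_ordinal: "x < succ_ordinal x"
  by simp

lemma succ_ordinal_neq_zero [simp]: "succ_ordinal x \<noteq> 0"
  by (metis less_succ_ordinal not_less_zero_ordinal)

lemma one_ordinal_eq: "1 = succ_ordinal 0"
  by (simp add: one_ordinal_def succ_ordinal_def)

lemma one_neq_zero_ordinal [simp]: "1 \<noteq> (0 :: 'a ordinal)"
  by (simp add: one_ordinal_eq)

lemma limit_ordinal_iff: "limit_ordinal x \<longleftrightarrow> x \<noteq> 0 \<and> (\<forall>y < x. succ_ordinal y < x)"
proof -
  have "(\<forall>y. x \<noteq> succ_ordinal y) \<longleftrightarrow> (\<forall>y < x. succ_ordinal y < x)"
    using less_succ_ordinal by (auto simp: order.strict_iff_order)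
  then show ?thesis
    by (simp add: limit_ordinal_def)
qed

abbreviation fin :: "nat \<Rightarrow> 'a ordinal" where
  "fin n \<equiv> (succ_ordinal ^^ n) 0"

lemma less_omega_iff: "x < \<omega> \<longleftrightarrow> (\<exists>n. x = fin n)"
proof -
  \<comment> \<open>This z witnesses that limit ordinals exist; without a witness the LEAST defining
    \<omega> would say nothing.\<close>
  obtain z where z: "{..<z} = (\<Union>n. {..<fin n :: 'a ordinal})"
    by (rule sup_nat_ordinal)
  then have mem: "y < z \<longleftrightarrow> (\<exists>n. y < fin n)" for y :: "'a ordinal"
    by auto
  have "limit_ordinal z"
    unfolding limit_ordinal_iff
  proof (intro conjI allI impI)
    have "0 < z"
      unfolding mem by (intro exI[of _ 1]) simp
    then show "z \<noteq> 0"
      by auto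
    show "succ_ordinal y < z" if "y < z" for y
      using that unfolding mem by (metis funpow.simps(2) comp_apply succ_ordinal_less_iff)
  qed
  then have lim: "limit_ordinal (\<omega> :: 'a ordinal)"
    unfolding omega_def by (rule LeastI)
  have "fin n < (\<omega> :: 'a ordinal)" for n
  proof (induction n)
    case 0
    then show ?case
      using lim by (simp add: limit_ordinal_iff zero_less_ordinal_iff)
  next
    case (Suc n)
    then show ?case
      using lim by (simp add: limit_ordinal_iff)
  qed
  moreover have "\<exists>n. y = fin n" if "y < \<omega>" for y :: "'a ordinal"
    using that
  proof (induction y rule: less_induct)
    case (less y)
    have "\<not> limit_ordinal y"
      using less.prems unfolding omega_def by (rule not_less_Least)
    then consider "y = 0" | u where "y = succ_ordinal u"
      by (auto simp: limit_ordinal_def)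
    then show ?case
    proof cases
      case 1
      then show ?thesis
        by (intro exI[of _ 0]) simp
    next
      case 2
      then have "u < y" by simp
      with less obtain n where "u = fin n"
        using order.strict_trans by blast
      with 2 show ?thesis
        by (intro exI[of _ "Suc n"]) simp
    qed
  qed
  ultimately show ?thesis by blast
qed

section \<open>Addition\<close>

text \<open>Replaces the recursion by a test for upper bounds. The candidates for LEAST are closed
  upwards, and there is one because small sets of ordinals are bounded. Products and powers of
  \<omega> are treated in the same way.\<close>

lemma add_le_iff_ordinal: "x + y \<le> z \<longleftrightarrow> x \<le> z \<and> (\<forall>y' < y. x + y' < (z :: 'a ordinal))"
proof -
  let ?P = "\<lambda>z. x \<le> z \<and> (\<forall>y' < y. x + y' < z)"
  have eq: "x + y = (LEAST z. ?P z)"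
    unfolding plus_ordinal_def by (subst oadd.simps) (simp add: Ball_def)
  obtain u where u: "\<forall>y' < y. x + y' < u"
    using ex_greater_lessThan by blast
  have "?P (max x u)"
    using u by (auto simp: less_max_iff_disj)
  then have "?P (x + y)"
    unfolding eq by (rule LeastI)
  moreover have "x + y \<le> z" if "?P z"
    using that unfolding eq by (rule Least_le)
  ultimately show ?thesis
    by (meson order.trans less_le_trans)
qed

lemma le_add1_ordinal [simp]: "x \<le> x + (y :: 'a ordinal)"
  using add_le_iff_ordinal[of x y "x + y"] by simp

lemma not_add_less_ordinal [simp]: "\<not> x + y < (x :: 'a ordinal)"
  by (simp add: not_less)

lemma add_strict_left_mono_ordinal: "y' < y \<Longrightarrow> x + y' < x + (y :: 'a ordinal)"
  using add_le_iff_ordinal[of x y "x + y"] by simp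

lemma add_less_cancel_left_ordinal [simp]: "x + y' < x + y \<longleftrightarrow> y' < (y :: 'a ordinal)"
  by (metis add_strict_left_mono_ordinal linorder_less_linear order_less_asym)

lemma add_le_cancel_left_ordinal [simp]: "x + y' \<le> x + y \<longleftrightarrow> y' \<le> (y :: 'a ordinal)"
  by (meson add_less_cancel_left_ordinal not_less)

lemma add_left_cancel_ordinal [simp]: "x + y' = x + y \<longleftrightarrow> y' = (y :: 'a ordinal)"
  by (metis add_less_cancel_left_ordinal neq_iff)

lemma add_mono_ordinal: "x \<le> x' \<Longrightarrow> y \<le> y' \<Longrightarrow> x + y \<le> x' + (y' :: 'a ordinal)"
proof (induction y arbitrary: y' rule: less_induct)
  case (less y)
  then show ?case
    unfolding add_le_iff_ordinal[of x y]
    by (meson add_less_cancel_left_ordinal le_add1_ordinal less_le_trans order.refl order.trans le_less_trans)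
qed

lemma ex_diff_ordinal: "x \<le> w \<Longrightarrow> \<exists>d. x + d = (w :: 'a ordinal)"
proof -
  assume x: "x \<le> w"
  let ?d = "LEAST d. w \<le> x + d"
  have zero: "y \<le> 0 + y" for y :: "'a ordinal"
  proof (induction y rule: less_induct)
    case (less y)
    then show ?case
      by (meson add_less_cancel_left_ordinal le_less_trans not_less order.strict_implies_order order_less_irrefl)
  qed
  have "w \<le> x + w"
    using zero[of w] add_mono_ordinal[of 0 x w w] by (meson order.refl order.trans zero_le_ordinal)
  then have "w \<le> x + ?d"
    by (rule LeastI)
  moreover have "x + ?d \<le> w"
    unfolding add_le_iff_ordinal using x not_less_Least not_le by blast
  ultimately show ?thesis
    by (metis antisym)
qed

lemma less_add_ordinal_cases:
  assumes "v < x + (y :: 'a ordinal)"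
  obtains "v < x" | y' where "y' < y" "v = x + y'"
  using assms by (metis add_less_cancel_left_ordinal ex_diff_ordinal not_less)

instance ordinal :: (type) monoid_add
proof
  fix x y z :: "'a ordinal"
  show "x + 0 = x"
    by (rule antisym) (simp_all add: add_le_iff_ordinal)
  show "0 + x = x"
  proof (induction x rule: less_induct)
    case (less x)
    then have "0 + x \<le> x"
      by (simp add: add_le_iff_ordinal)
    moreover have "x \<le> 0 + x"
      using less by (metis add_less_cancel_left_ordinal less_irrefl not_less)
    ultimately show ?case by simp
  qed
  show "x + y + z = x + (y + z)"
  proof (induction z rule: less_induct)
    case (less z)
    show ?case
    proof (rule antisym)
      show "x + y + z \<le> x + (y + z)"
        using less by (simp add: add_le_iff_ordinal[of "x + y"])
      have "x + v < x + y + z" if "v < y + z" for v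
        using that
      proof (cases rule: less_add_ordinal_cases)
        case 1
        then show ?thesis
          by (meson add_less_cancel_left_ordinal le_add1_ordinal less_le_trans)
      next
        case (2 z')
        then show ?thesis
          by (simp flip: less)
      qed
      then show "x + (y + z) \<le> x + y + z"
        unfolding add_le_iff_ordinal[of x "y + z"] by (meson le_add1_ordinal order.trans)
    qed
  qed
qed

lemma le_add2_ordinal [simp]: "y \<le> x + (y :: 'a ordinal)"
  using add_mono_ordinal[of 0 x y y] by simp

lemma add_succ_ordinal: "x + succ_ordinal y = succ_ordinal (x + y)"
  by (rule antisym) (auto simp: add_le_iff_ordinal[of x "succ_ordinal y"] intro: order.strict_implies_order le_less_trans)

lemma add_one_ordinal: "x + 1 = succ_ordinal x"
  by (simp add: one_ordinal_eq add_succ_ordinal)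

text \<open>Left subtraction, truncated to \<open>0\<close> if \<open>w < x\<close>.\<close>

definition osub :: "'a ordinal \<Rightarrow> 'a ordinal \<Rightarrow> 'a ordinal" where
  "osub w x = (THE d. x + d = max x w)"

lemma osub_eqI: "x + d = w \<Longrightarrow> osub w x = d"
  unfolding osub_def by (rule the_equality) (auto simp: max_absorb2)

lemma add_osub_max: "x + osub w x = max x w"
  using ex_diff_ordinal[of x "max x w"] osub_eqI[of x _ "max x w"] by (auto simp: osub_def)

lemma add_osub [simp]: "x \<le> w \<Longrightarrow> x + osub w x = w"
  by (simp add: add_osub_max max_absorb2)

text \<open>Truncation makes subtraction a left adjoint of \<open>\<lambda>d. x + d\<close> without
  a side condition: for w < x both sides are true.\<close>

lemma osub_le_iff: "osub w x \<le> d \<longleftrightarrow> w \<le> x + d"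
proof -
  have "osub w x \<le> d \<longleftrightarrow> max x w \<le> x + d"
    by (simp flip: add_osub_max)
  then show ?thesis
    by simp
qed

lemma less_osub_iff: "d < osub w x \<longleftrightarrow> x + d < w"
  using osub_le_iff[of w x d] by (simp flip: not_le)

lemma osub_add [simp]: "osub (x + d) x = d"
  by (rule osub_eqI) simp

section \<open>Powers of \<open>\<omega>\<close>\<close>

lemma mult_le_iff_ordinal: "x * y \<le> z \<longleftrightarrow> (\<forall>y' < y. x * y' + x \<le> (z :: 'a ordinal))"
proof -
  let ?P = "\<lambda>z. \<forall>y' < y. x * y' + x \<le> z"
  have eq: "x * y = (LEAST z. ?P z)"
    unfolding times_ordinal_def plus_ordinal_def by (subst omult.simps) (simp add: Ball_def)
  obtain u where "\<forall>y' < y. x * y' + x < u"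
    using ex_greater_lessThan[of y "\<lambda>y'. x * y' + x"] by blast
  then have "?P u"
    by (auto intro: less_imp_le)
  then have "?P (x * y)"
    unfolding eq by (rule LeastI)
  moreover have "x * y \<le> z" if "?P z"
    using that unfolding eq by (rule Least_le)
  ultimately show ?thesis
    by (meson order.trans)
qed

lemma mult_zero_ordinal [simp]: "x * 0 = (0 :: 'a ordinal)"
  using mult_le_iff_ordinal[of x 0 0] by simp

lemma mult_mono_right_ordinal: "y \<le> y' \<Longrightarrow> x * y \<le> x * (y' :: 'a ordinal)"
  by (meson mult_le_iff_ordinal less_le_trans order.refl)

lemma mult_succ_ordinal: "x * succ_ordinal y = x * y + x"
proof (rule antisym)
  show "x * succ_ordinal y \<le> x * y + x"
    unfolding mult_le_iff_ordinal[of x "succ_ordinal y"]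
    by (simp add: add_mono_ordinal mult_mono_right_ordinal)
  show "x * y + x \<le> x * succ_ordinal y"
    using mult_le_iff_ordinal[of x "succ_ordinal y" "x * succ_ordinal y"] by simp
qed

lemma mult_fin_Suc [simp]: "x * fin (Suc n) = x * fin n + (x :: 'a ordinal)"
  by (simp add: mult_succ_ordinal)

declare funpow.simps(2) [simp del]

lemma mult_omega_le_iff: "x * \<omega> \<le> z \<longleftrightarrow> (\<forall>n. x * fin n \<le> (z :: 'a ordinal))"
proof
  assume "x * \<omega> \<le> z"
  then show "\<forall>n. x * fin n \<le> z"
    using mult_mono_right_ordinal[of "fin _" \<omega> x] less_omega_iff by (metis order.strict_implies_order order.trans)
next
  assume "\<forall>n. x * fin n \<le> z"
  then have "\<forall>n. x * fin n + x \<le> z"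
    by (metis mult_fin_Suc)
  then show "x * \<omega> \<le> z"
    by (auto simp: mult_le_iff_ordinal[of x \<omega>] less_omega_iff)
qed

lemma mult_fin_add: "x * fin (m + n) = x * fin m + x * (fin n :: 'a ordinal)"
  by (induction n) (simp_all flip: add.assoc)

lemma mult_fin_less_omega: "x \<noteq> 0 \<Longrightarrow> x * fin n < x * (\<omega> :: 'a ordinal)"
proof -
  assume "x \<noteq> 0"
  then have "x * fin n < x * fin (Suc n)"
    using add_strict_left_mono_ordinal[of 0 x] by (simp add: zero_less_ordinal_iff)
  also have "\<dots> \<le> x * \<omega>"
    using mult_omega_le_iff by blast
  finally show ?thesis .
qed

lemma omega_power_le_iff:
  "omega_power x \<le> z \<longleftrightarrow> 1 \<le> z \<and> (\<forall>x' < x. omega_power x' * \<omega> \<le> (z :: 'a ordinal))"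
proof -
  let ?P = "\<lambda>z. 1 \<le> z \<and> (\<forall>x' < x. omega_power x' * \<omega> \<le> z)"
  have eq: "omega_power x = (LEAST z. ?P z)"
    by (subst omega_power.simps) (simp add: Ball_def)
  obtain u where "\<forall>x' < x. omega_power x' * \<omega> < u"
    using ex_greater_lessThan[of x "\<lambda>x'. omega_power x' * \<omega>"] by blast
  then have "?P (max 1 u)"
    by (auto simp: le_max_iff_disj intro: less_imp_le)
  then have "?P (omega_power x)"
    unfolding eq by (rule LeastI)
  moreover have "omega_power x \<le> z" if "?P z"
    using that unfolding eq by (rule Least_le)
  ultimately show ?thesis
    by (meson order.trans)
qed

lemma one_le_omega_power [simp]: "1 \<le> omega_power x"
  using omega_power_le_iff[of x "omega_power x"] by simp

lemma omega_power_zero [simp]: "omega_power 0 = (1 :: 'a ordinal)"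
  by (rule antisym) (simp_all add: omega_power_le_iff[of "0 :: 'a ordinal" 1])

lemma omega_power_neq_zero [simp]: "omega_power x \<noteq> 0"
  using one_le_omega_power[of x] by (auto simp: one_ordinal_eq)

lemma omega_power_pos [simp]: "0 < omega_power x"
  by (simp add: zero_less_ordinal_iff)

lemma mult_omega_le_omega_power: "x' < x \<Longrightarrow> omega_power x' * \<omega> \<le> omega_power x"
  using omega_power_le_iff[of x "omega_power x"] by simp

lemma mult_fin_less_omega_power: "x' < x \<Longrightarrow> omega_power x' * fin n < omega_power x"
  by (meson mult_fin_less_omega mult_omega_le_omega_power omega_power_neq_zero less_le_trans)

lemma omega_power_strict_mono: "x' < x \<Longrightarrow> omega_power x' < omega_power x"
  using mult_fin_less_omega_power[of x' x "Suc 0"] by simp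

lemma omega_power_less_iff [simp]: "omega_power x' < omega_power x \<longleftrightarrow> x' < x"
  by (metis omega_power_strict_mono linorder_less_linear order_less_asym)

lemma omega_power_mono [simp]: "omega_power x' \<le> omega_power x \<longleftrightarrow> x' \<le> x"
  by (meson omega_power_less_iff not_less)

lemma less_omega_powerE:
  assumes "a < omega_power x"
  obtains "a = 0" | x' n where "x' < x" "a < omega_power x' * fin n"
proof -
  have "a < 1 \<or> (\<exists>x' < x. \<exists>n. a < omega_power x' * fin n)"
    using assms unfolding not_le[symmetric] omega_power_le_iff mult_omega_le_iff by blast
  then show thesis
    using that by (auto simp: one_ordinal_eq)
qed

text \<open>Nonzero a and b lie below finite multiples of smaller powers; the larger of the two
  exponents serves for both.\<close>

lemma omega_power_indecomposable:
  assumes "a < omega_power x" "b < omega_power x"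
  shows "a + b < omega_power x"
proof (cases "a = 0 \<or> b = 0")
  case True
  then show ?thesis using assms by auto
next
  case False
  from assms(1) False obtain u m where u: "u < x" "a < omega_power u * fin m"
    by (auto elim: less_omega_powerE)
  from assms(2) False obtain v n where v: "v < x" "b < omega_power v * fin n"
    by (auto elim: less_omega_powerE)
  have mono: "omega_power w * fin n \<le> omega_power (max u v) * fin n" if "w \<le> max u v" for w n
    using that by (induction n) (simp_all add: add_mono_ordinal)
  have "a \<le> omega_power (max u v) * fin m" "b \<le> omega_power (max u v) * fin n"
    using u v mono[of u m] mono[of v n] by auto
  then have "a + b \<le> omega_power (max u v) * fin (m + n)"
    by (simp add: mult_fin_add add_mono_ordinal)
  also have "\<dots> < omega_power x"
    using u v by (intro mult_fin_less_omega_power) simp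
  finally show ?thesis .
qed

lemma omega_power_absorb: "a < omega_power x \<Longrightarrow> a + omega_power x = omega_power x"
  by (rule antisym) (simp_all add: add_le_iff_ordinal[of a] omega_power_indecomposable)

lemma le_omega_power: "x \<le> omega_power x"
proof (induction x rule: less_induct)
  case (less x)
  show ?case
  proof (rule ccontr)
    assume "\<not> x \<le> omega_power x"
    then have "omega_power x < x" by simp
    with less[OF this] show False
      using omega_power_less_iff[of "omega_power x" x] by simp
  qed
qed

lemma less_omega_power_succE:
  assumes "y < omega_power (succ_ordinal x)"
  obtains n where "y < omega_power x * fin n"
  using assms
proof (cases rule: less_omega_powerE)
  case 1
  then show ?thesis
    using that[of "Suc 0"] by simp
next
  case (2 x' n)
  have "omega_power x' * fin n \<le> omega_power x * fin n"
    using 2(1) by (induction n) (simp_all add: add_mono_ordinal)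
  with 2 show ?thesis
    using that[of n] by simp
qed

text \<open>If \<open>?x\<close> is the least exponent whose power exceeds z, the recursion for that
  power supplies an x < \<open>?x\<close> with z below a finite multiple of omega^x, and minimality
  gives omega^x \<le> z.\<close>

lemma ex_leading_omega_power:
  assumes "z \<noteq> 0"
  obtains x where "omega_power x \<le> z" "z < omega_power (succ_ordinal x)"
proof -
  let ?x = "LEAST x. z < omega_power x"
  have "z < omega_power (succ_ordinal z)"
    using le_omega_power[of "succ_ordinal z"] by simp
  then have least: "z < omega_power ?x"
    by (rule LeastI)
  then obtain x n where x: "x < ?x" "z < omega_power x * fin n"
    using assms by (auto elim: less_omega_powerE)
  have "omega_power x \<le> z"
    using not_less_Least[OF x(1)] by simp
  moreover have "z < omega_power (succ_ordinal x)"
    using x mult_fin_less_omega_power[of x "succ_ordinal x" n] by simp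
  ultimately show thesis ..
qed

section \<open>Cantor normal forms as multisets of exponents\<close>

lemma nf_value_Nil [simp]: "nf_value [] = 0"
  and nf_value_Cons [simp]: "nf_value (x # xs) = omega_power x + nf_value xs"
  by (simp_all add: nf_value_def)

lemma nf_value_append: "nf_value (xs @ ys) = nf_value xs + nf_value ys"
  by (induction xs) (simp_all add: add.assoc)

definition cnf_value :: "'a ordinal multiset \<Rightarrow> 'a ordinal" where
  "cnf_value M = nf_value (rev (sorted_list_of_multiset M))"

lemma sorted_wrt_ge_unique:
  fixes xs :: "'b :: linorder list"
  assumes "sorted_wrt (\<ge>) xs"
  shows "xs = rev (sorted_list_of_multiset (mset xs))"
proof -
  have "sort xs = rev xs"
    using assms by (intro properties_for_sort) (simp_all add: sorted_wrt_rev)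
  then show ?thesis
    by simp
qed

lemma sorted_wrt_ge_rev_sorted_list:
  "sorted_wrt (\<ge>) (rev (sorted_list_of_multiset (M :: 'b :: linorder multiset)))"
  by (simp add: sorted_wrt_rev)

lemma cnf_value_mset: "sorted_wrt (\<ge>) xs \<Longrightarrow> cnf_value (mset xs) = nf_value xs"
  unfolding cnf_value_def using sorted_wrt_ge_unique by metis

lemma cnf_value_empty [simp]: "cnf_value {#} = 0"
  by (simp add: cnf_value_def)

lemma cnf_value_single [simp]: "cnf_value {#x#} = omega_power x"
  by (simp add: cnf_value_def)

lemma cnf_value_add:
  assumes "\<And>x y. x \<in># P \<Longrightarrow> y \<in># Q \<Longrightarrow> y \<le> x"
  shows "cnf_value (P + Q) = cnf_value P + cnf_value Q"
proof -
  let ?xs = "rev (sorted_list_of_multiset P)" and ?ys = "rev (sorted_list_of_multiset Q)"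
  have "sorted_wrt (\<ge>) (?xs @ ?ys)"
    using assms by (auto simp: sorted_wrt_append sorted_wrt_ge_rev_sorted_list)
  from cnf_value_mset[OF this] show ?thesis
    by (simp add: nf_value_append cnf_value_def)
qed

lemma cnf_value_less_omega_power:
  assumes "\<And>y. y \<in># Q \<Longrightarrow> y < x"
  shows "cnf_value Q < omega_power x"
proof -
  have "nf_value xs < omega_power x" if "\<forall>y \<in> set xs. y < x" for xs
    using that by (induction xs) (simp_all add: omega_power_indecomposable)
  then show ?thesis
    using assms by (simp add: cnf_value_def)
qed

text \<open>At the largest exponent x where the multiplicities differ, N has the surplus. The part P
  of M from x upwards begins both sums; after it N still has an omega^x, which exceeds all that
  remains of M.\<close>

lemma cnf_value_strict_mono:
  assumes "M < N"
  shows "cnf_value M < cnf_value N"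
proof -
  define D where "D = {x \<in> set_mset M \<union> set_mset N. count M x \<noteq> count N x}"
  have ne: "M \<noteq> N" and up: "\<And>y. count N y < count M y \<Longrightarrow> \<exists>x > y. count M x < count N x"
    using assms unfolding less_multiset\<^sub>H\<^sub>O by auto
  have D: "finite D" by (simp add: D_def)
  have memD: "y \<in> D" if "count M y \<noteq> count N y" for y
    using that by (auto simp: D_def not_in_iff)
  have "D \<noteq> {}"
    using ne memD by (metis empty_iff multiset_eqI)
  define x where "x = Max D"
  have "x \<in> D"
    unfolding x_def using D \<open>D \<noteq> {}\<close> by (rule Max_in)
  have above: "count M y = count N y" if "x < y" for y
    using Max_ge[OF D, of y] memD[of y] that by (auto simp: x_def not_le[symmetric])
  have less: "count M x < count N x"
    using \<open>x \<in> D\<close> up[of x] above by (force simp: D_def)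
  define P where "P = filter_mset ((\<le>) x) M"
  define N0 where "N0 = N - add_mset x P"
  have "add_mset x P \<subseteq># N"
    unfolding subseteq_mset_def P_def using less above
    by (auto simp: order.order_iff_strict)
  then have "N = add_mset x P + N0"
    by (simp only: N0_def subset_mset.add_diff_inverse)
  then have N: "N = P + add_mset x N0"
    by simp
  have N0: "y \<le> x" if "y \<in># N0" for y
  proof (rule ccontr)
    assume "\<not> y \<le> x"
    then have y: "x < y" "x \<le> y" "x \<noteq> y" by auto
    have "count N0 y = 0"
      using above[OF y(1)] y(2,3) by (simp add: N0_def P_def)
    with that show False by (simp add: count_eq_zero_iff)
  qed
  define M0 where "M0 = filter_mset (\<lambda>y. \<not> x \<le> y) M"
  have "cnf_value M = cnf_value (P + M0)"
    by (simp add: P_def M0_def)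
  also have "\<dots> = cnf_value P + cnf_value M0"
    by (intro cnf_value_add) (auto simp: P_def M0_def)
  also have "\<dots> < cnf_value P + omega_power x"
    unfolding add_less_cancel_left_ordinal by (rule cnf_value_less_omega_power) (auto simp: M0_def)
  also have "\<dots> \<le> cnf_value P + (omega_power x + cnf_value N0)"
    by simp
  also have "omega_power x + cnf_value N0 = cnf_value (add_mset x N0)"
    using cnf_value_add[of "{#x#}" N0] N0 by simp
  also have "cnf_value P + cnf_value (add_mset x N0) = cnf_value N"
    unfolding N using N0 by (intro cnf_value_add[symmetric]) (auto simp: P_def intro: order.trans)
  finally show ?thesis .
qed

lemma cnf_value_mono: "M \<le> N \<Longrightarrow> cnf_value M \<le> cnf_value N"
  by (metis cnf_value_strict_mono order.order_iff_strict)

lemma ex_cnf_value: "\<exists>M. cnf_value M = z"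
proof (induction z rule: less_induct)
  case (less z)
  show ?case
  proof (cases "z = 0")
    case True
    then show ?thesis
      by (intro exI[of _ "{#}"]) simp
  next
    case False
    then obtain x where x: "omega_power x \<le> z" "z < omega_power (succ_ordinal x)"
      by (rule ex_leading_omega_power)
    define z' where "z' = osub z (omega_power x)"
    have z: "omega_power x + z' = z"
      using x by (simp add: z'_def)
    \<comment> \<open>If the remainder were z itself, z would absorb omega^x on its left any number
      of times and thus be at least omega^x * n for every n.\<close>
    have "z' < z"
    proof (rule ccontr)
      assume "\<not> z' < z"
      then have "z' = z"
        using z le_add2_ordinal[of z' "omega_power x"] by simp
      with z have eq: "omega_power x + z = z" by simp
      have le: "omega_power x * fin n + z = z" for n
        by (induction n) (simp_all add: add.assoc eq)
      obtain n where "z < omega_power x * fin n"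
        using x(2) by (rule less_omega_power_succE)
      with le[of n] show False
        using le_add1_ordinal[of "omega_power x * fin n" z] by simp
    qed
    with less obtain M where M: "cnf_value M = z'"
      by blast
    have "y \<le> x" if "y \<in># M" for y
    proof (rule ccontr)
      assume "\<not> y \<le> x"
      then have "{#x#} < M"
        using that by (intro ex_gt_imp_less_multiset) auto
      then have "{#succ_ordinal x#} \<le> M"
        using that \<open>\<not> y \<le> x\<close> by (metis (no_types, lifting) mset_subset_eq_single mset_le_single_iff not_le order.trans subset_eq_imp_le_multiset succ_ordinal_le_iff)
      then have "omega_power (succ_ordinal x) \<le> z'"
        using cnf_value_mono[of "{#succ_ordinal x#}" M] M by simp
      with \<open>z' < z\<close> x(2) show False
        by simp
    qed
    then have "cnf_value (add_mset x M) = z"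
      using cnf_value_add[of "{#x#}" M] M z by simp
    then show ?thesis ..
  qed
qed

definition cnf :: "'a ordinal \<Rightarrow> 'a ordinal multiset" where
  "cnf z = mset (normal_form z)"

lemma cnf_value_inj: "cnf_value M = cnf_value N \<Longrightarrow> M = N"
  using cnf_value_strict_mono[of M N] cnf_value_strict_mono[of N M]
  by (metis less_irrefl linorder_less_linear)

lemma normal_form_cnf_value: "normal_form (cnf_value M) = rev (sorted_list_of_multiset M)"
  unfolding normal_form_def
proof (rule the_equality)
  show "sorted_wrt (\<ge>) (rev (sorted_list_of_multiset M)) \<and>
      nf_value (rev (sorted_list_of_multiset M)) = cnf_value M"
    by (simp add: sorted_wrt_ge_rev_sorted_list cnf_value_def)
  fix xs assume xs: "sorted_wrt (\<ge>) xs \<and> nf_value xs = cnf_value M"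
  then have "mset xs = M"
    by (simp add: cnf_value_mset cnf_value_inj)
  with xs show "xs = rev (sorted_list_of_multiset M)"
    using sorted_wrt_ge_unique by blast
qed

lemma cnf_cnf_value [simp]: "cnf (cnf_value M) = M"
  by (simp add: cnf_def normal_form_cnf_value)

lemma cnf_value_cnf [simp]: "cnf_value (cnf z) = z"
  using ex_cnf_value[of z] by auto

lemma normal_form_eq: "normal_form z = rev (sorted_list_of_multiset (cnf z))"
  using normal_form_cnf_value[of "cnf z"] by simp

lemma cnf_less_iff [simp]: "cnf x < cnf y \<longleftrightarrow> x < y"
  using cnf_value_strict_mono[of "cnf x" "cnf y"] cnf_value_strict_mono[of "cnf y" "cnf x"]
  by (metis cnf_value_cnf less_asym linorder_less_linear)

lemma cnf_le_iff [simp]: "cnf x \<le> cnf y \<longleftrightarrow> x \<le> y"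
  by (simp flip: not_less)

lemma cnf_eq_iff [simp]: "cnf x = cnf y \<longleftrightarrow> x = y"
  by (metis cnf_value_cnf)

lemma cnf_zero [simp]: "cnf 0 = {#}"
  using cnf_cnf_value[of "{#}"] by simp

lemma cnf_omega_power [simp]: "cnf (omega_power x) = {#x#}"
  using cnf_cnf_value[of "{#x#}"] by simp

lemma cnf_eq_empty_iff [simp]: "cnf z = {#} \<longleftrightarrow> z = 0"
  using cnf_eq_iff[of z 0] by (simp del: cnf_eq_iff)

lemma cnf_add_concat:
  "(\<And>a b. a \<in># cnf x \<Longrightarrow> b \<in># cnf y \<Longrightarrow> b \<le> a) \<Longrightarrow> cnf (x + y) = cnf x + cnf y"
  using cnf_value_add[of "cnf x" "cnf y"] cnf_cnf_value[of "cnf x + cnf y"] by simp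

lemma less_omega_power_iff: "z < omega_power x \<longleftrightarrow> (\<forall>e \<in># cnf z. e < x)"
  using cnf_less_iff[of z "omega_power x"] by (simp del: cnf_less_iff)

text \<open>Any exponent m of y will do, because it is at most the leading one; x is then below the
  leading power of y and vanishes in front of it.\<close>

lemma cnf_add_absorb:
  assumes m: "m \<in># cnf y" and less: "\<And>d. d \<in># cnf x \<Longrightarrow> d < m"
  shows "x + y = y"
proof -
  define n where "n = Max (set_mset (cnf y))"
  have n: "n \<in># cnf y"
    unfolding n_def using m by (intro Max_in) auto
  have max: "e \<le> n" if "e \<in># cnf y" for e
    unfolding n_def using that by simp
  define w where "w = cnf_value (cnf y - {#n#})"
  have "cnf_value (cnf y) = cnf_value ({#n#} + (cnf y - {#n#}))"
    using n by simp
  also have "\<dots> = omega_power n + w"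
    unfolding w_def using max by (subst cnf_value_add) (auto dest: in_diffD)
  finally have y: "y = omega_power n + w"
    by simp
  have "x < omega_power n"
    using less max[OF m] by (auto simp: less_omega_power_iff intro: less_le_trans)
  then show ?thesis
    by (simp add: y omega_power_absorb flip: add.assoc)
qed

lemma cnf_add:
  assumes "y \<noteq> 0"
  shows "cnf (x + y) = filter_mset (\<lambda>e. Max (set_mset (cnf y)) \<le> e) (cnf x) + cnf y"
proof -
  let ?m = "Max (set_mset (cnf y))"
  have m: "?m \<in># cnf y"
    using assms by (intro Max_in) auto
  define c where "c = cnf_value (filter_mset ((\<le>) ?m) (cnf x))"
  define d where "d = cnf_value (filter_mset (\<lambda>e. \<not> ?m \<le> e) (cnf x))"
  have "cnf_value (cnf x) = c + d"
    unfolding c_def d_def by (subst cnf_value_add[symmetric]) auto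
  moreover have "d + y = y"
    by (rule cnf_add_absorb[OF m]) (auto simp: d_def not_le)
  ultimately have "x + y = c + y"
    by (simp add: add.assoc)
  also have "cnf (c + y) = cnf c + cnf y"
    by (rule cnf_add_concat) (auto simp: c_def intro: order.trans[OF Max_ge])
  finally show ?thesis
    by (simp add: c_def)
qed

section \<open>The natural operations on normal forms\<close>

lemma cnf_nat_sum [simp]: "cnf (x \<sharp> y) = cnf x + cnf y"
proof -
  have "x \<sharp> y = cnf_value (mset (normal_form x @ normal_form y))"
    by (simp only: nat_sum_def cnf_value_def sorted_list_of_multiset_mset)
  then show ?thesis
    by (simp add: cnf_def[of x] cnf_def[of y])
qed

lemma cnf_nat_sum_list: "cnf (nat_sum_list xs) = (\<Sum>x\<leftarrow>xs. cnf x)"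
  by (induction xs) (simp_all add: nat_sum_list_def)

lemma nat_sum_list_sorted_list:
  "finite F \<Longrightarrow> cnf (nat_sum_list (map f (sorted_list_of_set F))) = (\<Sum>i\<in>F. cnf (f i))"
  by (simp add: cnf_nat_sum_list sum_list_distinct_conv_sum_set comp_def)

text \<open>Ordinary addition deletes terms of x that the natural sum keeps. Estimates for
  differences of ordinals pass to multisets through this inequality.\<close>

lemma cnf_add_le_nat_sum: "cnf (x + y) \<le> cnf x + cnf y"
  by (cases "y = 0") (simp_all add: cnf_add subset_eq_imp_le_multiset)

lemma cnf_one [simp]: "cnf 1 = {#0#}"
  using cnf_omega_power[of 0] by simp

lemma one_mult_fin: "1 * fin n = fin n"
  by (induction n) (simp_all add: add_one_ordinal mult_succ_ordinal funpow.simps(2))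

lemma omega_eq_omega_power_one: "\<omega> = omega_power 1"
proof -
  have omega: "1 * \<omega> = (\<omega> :: 'a ordinal)"
  proof (rule antisym)
    show "1 * \<omega> \<le> (\<omega> :: 'a ordinal)"
      by (simp add: mult_omega_le_iff one_mult_fin) (meson less_imp_le less_omega_iff)
    have "x < 1 * \<omega>" if "x < \<omega>" for x :: "'a ordinal"
      using that mult_fin_less_omega[of "1 :: 'a ordinal"]
      by (auto simp: less_omega_iff one_mult_fin)
    then show "\<omega> \<le> 1 * (\<omega> :: 'a ordinal)"
      using not_less by blast
  qed
  have "1 < (\<omega> :: 'a ordinal)"
    unfolding less_omega_iff by (intro exI[of _ "Suc 0"]) (simp add: one_ordinal_eq funpow.simps(2))
  then show ?thesis
    using mult_omega_le_omega_power[of 0 "1 :: 'a ordinal"] omega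
    by (intro antisym)
      (auto simp: omega_power_le_iff[of 1] zero_less_ordinal_iff one_ordinal_eq[symmetric]
        less_succ_ordinal_iff[of _ 0, folded one_ordinal_eq] intro: less_imp_le)
qed

lemma nat_sum_one: "x \<sharp> 1 = succ_ordinal x"
proof -
  have "cnf (x \<sharp> 1) = cnf (x + 1)"
    by (subst cnf_add_concat) simp_all
  then show ?thesis
    by (simp only: cnf_eq_iff add_one_ordinal)
qed

text \<open>Since \<omega> is omega^1, the product adds 1 naturally to each exponent, and
  \<open>x \<sharp> 1\<close> is the successor of x.\<close>

lemma cnf_nat_prod_omega: "cnf (x \<otimes> \<omega>) = image_mset succ_ordinal (cnf x)"
proof -
  have "normal_form (\<omega> :: 'a ordinal) = [1]"
    by (simp add: normal_form_eq omega_eq_omega_power_one)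
  moreover have "concat (map (\<lambda>a. [f a]) xs) = map f xs" for f :: "'a ordinal \<Rightarrow> 'a ordinal" and xs
    by (induction xs) simp_all
  moreover have "(\<Sum>a\<leftarrow>xs. {#f a#}) = mset (map f xs)" for f :: "'a ordinal \<Rightarrow> 'a ordinal" and xs
    by (induction xs) simp_all
  ultimately show ?thesis
    by (simp add: nat_prod_def cnf_nat_sum_list comp_def nat_sum_one cnf_def[of x])
qed

lemma last_exp_eq: "z \<noteq> 0 \<Longrightarrow> last_exp z = Min (set_mset (cnf z))"
proof -
  assume "z \<noteq> 0"
  then have "sorted_list_of_multiset (cnf z) \<noteq> []"
    by (metis cnf_eq_empty_iff mset.simps(1) mset_sorted_list_of_multiset)
  then obtain x xs where xs: "sorted_list_of_multiset (cnf z) = x # xs"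
    by (cases "sorted_list_of_multiset (cnf z)") auto
  then have "last_exp z = x"
    by (simp add: last_exp_def normal_form_eq)
  moreover have "cnf z = add_mset x (mset xs)"
    by (metis xs mset.simps(2) mset_sorted_list_of_multiset)
  moreover have "sorted (x # xs)"
    by (metis xs sorted_sorted_list_of_multiset)
  ultimately show ?thesis
    by (auto intro!: Min_eqI[symmetric])
qed

lemma last_exp_in_cnf: "z \<noteq> 0 \<Longrightarrow> last_exp z \<in># cnf z"
  by (simp add: last_exp_eq)

lemma last_exp_le: "e \<in># cnf z \<Longrightarrow> last_exp z \<le> e"
  by (subst last_exp_eq) auto

lemma cnf_hat: "z \<noteq> 0 \<Longrightarrow> cnf (hat z) = cnf z - {#last_exp z#}"
proof -
  assume z: "z \<noteq> 0"
  have sorted: "sorted_wrt (\<ge>) (normal_form z)"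
    by (simp add: normal_form_eq sorted_wrt_ge_rev_sorted_list)
  have nonempty: "normal_form z \<noteq> []"
    using z by (metis cnf_def cnf_eq_empty_iff mset.simps(1))
  then have nf: "normal_form z = butlast (normal_form z) @ [last_exp z]"
    by (simp add: last_exp_def)
  then have "sorted_wrt (\<ge>) (butlast (normal_form z))"
    using sorted by (metis sorted_wrt_append)
  then have "cnf (hat z) = mset (butlast (normal_form z))"
    by (simp add: hat_def flip: cnf_value_mset)
  also have "\<dots> = cnf z - {#last_exp z#}"
    unfolding cnf_def by (subst (2) nf) simp
  finally show ?thesis .
qed

lemma cnf_eq_add_last_exp: "z \<noteq> 0 \<Longrightarrow> cnf z = add_mset (last_exp z) (cnf (hat z))"
  by (simp add: cnf_hat last_exp_in_cnf)

lemma hat_add_last_exp: "z \<noteq> 0 \<Longrightarrow> hat z + omega_power (last_exp z) = z"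
  by (subst cnf_eq_iff[symmetric], subst cnf_add_concat)
    (auto simp: cnf_eq_add_last_exp[of z] intro: last_exp_le)

lemma hat_less: "z \<noteq> 0 \<Longrightarrow> hat z < z"
  using add_strict_left_mono_ordinal[of 0 "omega_power (last_exp z)" "hat z"]
  by (simp add: hat_add_last_exp)

lemma last_exp_le_hat: "z \<noteq> 0 \<Longrightarrow> e \<in># cnf (hat z) \<Longrightarrow> last_exp z \<le> e"
  by (intro last_exp_le) (simp add: cnf_eq_add_last_exp)

section \<open>Realizations\<close>

text \<open>\<open>pos i x\<close> is the place in \<open>\<gamma>\<close> of the \<open>x\<close>-th element of \<open>A i\<close>, the inverse of the
  order isomorphism \<open>A i \<rightarrow> \<alpha> i\<close>.\<close>

definition realization ::
    "'a ordinal \<Rightarrow> ('i \<Rightarrow> 'a ordinal) \<Rightarrow> ('i \<Rightarrow> 'a ordinal \<Rightarrow> 'a ordinal) \<Rightarrow> bool" where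
  "realization \<gamma> \<alpha> pos \<longleftrightarrow>
     (\<forall>i x. x < \<alpha> i \<longrightarrow> pos i x < \<gamma>) \<and>
     (\<forall>i j x y. x < \<alpha> i \<longrightarrow> y < \<alpha> j \<longrightarrow> pos i x = pos j y \<longrightarrow> i = j \<and> x = y) \<and>
     (\<forall>\<delta> < \<gamma>. \<exists>i x. x < \<alpha> i \<and> pos i x = \<delta>) \<and>
     (\<forall>i x y. x < y \<longrightarrow> y < \<alpha> i \<longrightarrow> pos i x < pos i y) \<and>
     (\<forall>i x. x < \<alpha> i \<longrightarrow> finite {j. x < \<alpha> j \<and> pos j x < pos i x})"

lemma
  assumes "realization \<gamma> \<alpha> pos"
  shows realization_less: "x < \<alpha> i \<Longrightarrow> pos i x < \<gamma>"
    and realization_inj: "x < \<alpha> i \<Longrightarrow> y < \<alpha> j \<Longrightarrow> pos i x = pos j y \<Longrightarrow> i = j \<and> x = y"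
    and realization_surj: "\<delta> < \<gamma> \<Longrightarrow> \<exists>i x. x < \<alpha> i \<and> pos i x = \<delta>"
    and realization_mono: "x < y \<Longrightarrow> y < \<alpha> i \<Longrightarrow> pos i x < pos i y"
    and realization_finite: "x < \<alpha> i \<Longrightarrow> finite {j. x < \<alpha> j \<and> pos j x < pos i x}"
  using assms unfolding realization_def by blast+

text \<open>Identifies the arbitrary choice in \<open>the_iso\<close> with any concrete isomorphism.
  At a first disagreement, the smaller value would have to be taken by the other map at an earlier
  element, where the two maps agree.\<close>

lemma order_iso_onto_unique:
  assumes "order_iso_onto f A x" "order_iso_onto g A x" "a \<in> A"
  shows "f a = g a"
  using assms(3)
proof (induction a rule: less_induct)
  case (less a)
  have not_less: "\<not> f a < g a"
    if f: "order_iso_onto f A x" and g: "order_iso_onto g A x"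
      and IH: "\<And>b. b < a \<Longrightarrow> b \<in> A \<Longrightarrow> f b = g b" for f g
  proof
    assume lt: "f a < g a"
    have "f a \<in> g ` A"
      using f g less.prems unfolding order_iso_onto_def bij_betw_def by blast
    then obtain c where c: "c \<in> A" "g c = f a"
      by auto
    have "c < a"
    proof (rule ccontr)
      assume "\<not> c < a"
      then have "g a \<le> g c"
        using g c less.prems unfolding order_iso_onto_def
        by (metis order.order_iff_strict linorder_less_linear strict_mono_onD)
      with c lt show False by simp
    qed
    with IH c have "f c = f a"
      by simp
    moreover have "f c < f a"
      using f c \<open>c < a\<close> less.prems unfolding order_iso_onto_def by (meson strict_mono_onD)
    ultimately show False by simp
  qed
  from not_less[OF assms(1,2)] not_less[OF assms(2,1)] less.IH show ?case
    by (metis linorder_less_linear)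
qed

lemma orf_mixed_sum_iff: "orf_mixed_sum \<gamma> \<alpha> \<longleftrightarrow> (\<exists>pos. realization \<gamma> \<alpha> pos)"
proof
  assume "orf_mixed_sum \<gamma> \<alpha>"
  then obtain A where A: "realizes_mixed_sum \<gamma> \<alpha> A" "order_respecting_mod_finite \<alpha> A"
    unfolding orf_mixed_sum_def by blast
  define h where "h i = the_iso (A i) (\<alpha> i)" for i
  define pos where "pos i = the_inv_into (A i) (h i)" for i
  have h: "order_iso_onto (h i) (A i) (\<alpha> i)" for i
    using A(1) unfolding realizes_mixed_sum_def h_def the_iso_def by (metis someI_ex)
  then have inj: "inj_on (h i) (A i)" and image: "h i ` A i = {..<\<alpha> i}"
    and mono: "strict_mono_on (A i) (h i)" for i
    by (simp_all add: order_iso_onto_def bij_betw_def)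
  have pos: "pos i x \<in> A i" "h i (pos i x) = x" if "x < \<alpha> i" for i x
  proof -
    have "x \<in> h i ` A i"
      using image that by simp
    then show "pos i x \<in> A i" "h i (pos i x) = x"
      unfolding pos_def using inj by (simp_all add: the_inv_into_into f_the_inv_into_f)
  qed
  have pos_h: "pos i a = x \<and> a < \<alpha> i" if "x \<in> A i" "a = h i x" for i x a
    using that inj[of i] image[of i] by (auto simp: pos_def the_inv_into_f_f)
  have disj: "i = j" if "x \<in> A i" "x \<in> A j" for i j x
    using A(1) that unfolding realizes_mixed_sum_def disjoint_family_on_def by blast
  have union: "(\<Union>i. A i) = {..<\<gamma>}"
    using A(1) unfolding realizes_mixed_sum_def by blast
  have "realization \<gamma> \<alpha> pos"
    unfolding realization_def
  proof (intro conjI allI impI)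
    show "pos i x < \<gamma>" if "x < \<alpha> i" for i x
      using pos(1)[OF that] union by blast
    show "i = j" if "x < \<alpha> i" "y < \<alpha> j" "pos i x = pos j y" for i j x y
      using pos(1)[OF that(1)] pos(1)[OF that(2)] that(3) disj by metis
    then show "x = y" if "x < \<alpha> i" "y < \<alpha> j" "pos i x = pos j y" for i j x y
      using pos(2)[OF that(1)] pos(2)[OF that(2)] that by metis
    show "\<exists>i x. x < \<alpha> i \<and> pos i x = \<delta>" if "\<delta> < \<gamma>" for \<delta>
      using that union pos_h by (metis UN_E lessThan_iff)
    show "pos i x < pos i y" if "x < y" "y < \<alpha> i" for i x y
    proof (rule ccontr)
      assume "\<not> pos i x < pos i y"
      then have "h i (pos i y) \<le> h i (pos i x)"
        using mono[of i] pos(1)[of x i] pos(1)[of y i] that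
        by (metis linorder_less_linear order.order_iff_strict order.strict_trans strict_mono_onD)
      with that pos(2)[of x i] pos(2)[of y i] show False
        by simp
    qed
    show "finite {j. x < \<alpha> j \<and> pos j x < pos i x}" if x: "x < \<alpha> i" for i x
    proof (rule finite_subset)
      show "{j. x < \<alpha> j \<and> pos j x < pos i x} \<subseteq>
          {j. \<exists>\<theta> \<in> A j. \<theta> < pos i x \<and> h i (pos i x) \<le> h j \<theta>}"
        using pos x by force
      show "finite {j. \<exists>\<theta> \<in> A j. \<theta> < pos i x \<and> h i (pos i x) \<le> h j \<theta>}"
        using A(2) pos(1)[OF x] unfolding order_respecting_mod_finite_def h_def Let_def by blast
    qed
  qed
  then show "\<exists>pos. realization \<gamma> \<alpha> pos"
    by blast
next
  assume "\<exists>pos. realization \<gamma> \<alpha> pos"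
  then obtain pos where R: "realization \<gamma> \<alpha> pos" ..
  define A where "A i = pos i ` {..<\<alpha> i}" for i
  define h where "h i = inv_into {..<\<alpha> i} (pos i)" for i
  have inj: "inj_on (pos i) {..<\<alpha> i}" for i
    using realization_inj[OF R] by (auto simp: inj_on_def)
  have h_pos: "h i (pos i x) = x" if "x < \<alpha> i" for i x
    unfolding h_def using inj that by (intro inv_into_f_f) auto
  have h: "order_iso_onto (h i) (A i) (\<alpha> i)" for i
    unfolding order_iso_onto_def
  proof
    show "bij_betw (h i) (A i) {..<\<alpha> i}"
      unfolding A_def h_def by (intro bij_betw_inv_into inj_on_imp_bij_betw inj)
    show "strict_mono_on (A i) (h i)"
    proof (rule strict_mono_onI)
      fix a b assume "a \<in> A i" "b \<in> A i" "a < b"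
      then obtain x y where "x < \<alpha> i" "a = pos i x" "y < \<alpha> i" "b = pos i y"
        by (auto simp: A_def)
      with \<open>a < b\<close> show "h i a < h i b"
        using realization_mono[OF R, of y x i] h_pos
        by (metis less_asym linorder_less_linear less_irrefl)
    qed
  qed
  have iso: "the_iso (A i) (\<alpha> i) a = h i a" if "a \<in> A i" for i a
  proof (rule order_iso_onto_unique[OF _ h that])
    show "order_iso_onto (the_iso (A i) (\<alpha> i)) (A i) (\<alpha> i)"
      unfolding the_iso_def by (rule someI[where x = "h i"]) (rule h)
  qed
  have "realizes_mixed_sum \<gamma> \<alpha> A"
    unfolding realizes_mixed_sum_def
  proof (intro conjI)
    show "\<forall>i. \<exists>h. order_iso_onto h (A i) (\<alpha> i)"
      using h by blast
    show "disjoint_family A"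
      using realization_inj[OF R] by (fastforce simp: disjoint_family_on_def A_def)
    show "(\<Union>i. A i) = {..<\<gamma>}"
      using realization_less[OF R] realization_surj[OF R] by (fastforce simp: A_def)
  qed
  moreover have "order_respecting_mod_finite \<alpha> A"
    unfolding order_respecting_mod_finite_def Let_def
  proof (intro allI ballI)
    fix i \<eta> assume \<eta>: "\<eta> \<in> A i"
    then obtain x where x: "x < \<alpha> i" "\<eta> = pos i x"
      by (auto simp: A_def)
    show "finite {j. \<exists>\<theta> \<in> A j. \<theta> < \<eta> \<and> the_iso (A i) (\<alpha> i) \<eta> \<le> the_iso (A j) (\<alpha> j) \<theta>}"
    proof (rule finite_subset)
      show "finite {j. x < \<alpha> j \<and> pos j x < pos i x}"
        by (rule realization_finite[OF R x(1)])
      show "{j. \<exists>\<theta> \<in> A j. \<theta> < \<eta> \<and> the_iso (A i) (\<alpha> i) \<eta> \<le> the_iso (A j) (\<alpha> j) \<theta>} \<subseteq>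
          {j. x < \<alpha> j \<and> pos j x < pos i x}"
      proof
        fix j assume "j \<in> {j. \<exists>\<theta> \<in> A j. \<theta> < \<eta> \<and> the_iso (A i) (\<alpha> i) \<eta> \<le> the_iso (A j) (\<alpha> j) \<theta>}"
        then obtain \<theta> where \<theta>: "\<theta> \<in> A j" "\<theta> < \<eta>"
          and le: "the_iso (A i) (\<alpha> i) \<eta> \<le> the_iso (A j) (\<alpha> j) \<theta>"
          by blast
        then obtain y where y: "y < \<alpha> j" "\<theta> = pos j y"
          by (auto simp: A_def)
        \<comment> \<open>If some element of \<open>A j\<close> of rank at least x precedes \<eta>,
          so does the one of rank x. Hence \<open>realization\<close> only compares equal
          ranks.\<close>
        have "x \<le> y"
          using le \<theta> \<eta> x y by (simp add: iso h_pos)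
        then have "pos j x \<le> pos j y"
          using realization_mono[OF R, of x y j] y by (auto simp: order.order_iff_strict)
        with \<open>x \<le> y\<close> x y \<theta> show "j \<in> {j. x < \<alpha> j \<and> pos j x < pos i x}"
          by auto
      qed
    qed
  qed
  ultimately show "orf_mixed_sum \<gamma> \<alpha>"
    unfolding orf_mixed_sum_def by blast
qed

text \<open>As \<open>pos j\<close> increases, the part of \<open>A j\<close> before the cut is an
  initial segment of it. So the same \<open>pos\<close> serves and only the lengths change; the
  final finiteness is the order condition at the cut.\<close>

lemma realization_restrict:
  assumes R: "realization \<gamma> \<alpha> pos" and x: "x < \<alpha> i"
  obtains \<alpha>' where "realization (pos i x) \<alpha>' pos" "\<And>j. \<alpha>' j \<le> \<alpha> j" "\<alpha>' i = x"
    "finite {j. x < \<alpha>' j}"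
proof
  \<comment> \<open>The length left over from \<open>A j\<close> is the first rank that does not
    exist or is placed at or after the cut.\<close>
  let ?P = "\<lambda>j y. \<alpha> j \<le> y \<or> pos i x \<le> pos j y"
  define \<alpha>' where "\<alpha>' j = (LEAST y. ?P j y)" for j
  have least: "?P j (\<alpha>' j)" for j
    unfolding \<alpha>'_def by (rule LeastI[of _ "\<alpha> j"]) simp
  have less_iff: "y < \<alpha>' j \<longleftrightarrow> y < \<alpha> j \<and> pos j y < pos i x" for j y
  proof
    assume "y < \<alpha>' j"
    from not_less_Least[OF this[unfolded \<alpha>'_def]] show "y < \<alpha> j \<and> pos j y < pos i x"
      by (simp add: not_le)
  next
    assume y: "y < \<alpha> j \<and> pos j y < pos i x"
    show "y < \<alpha>' j"
    proof (rule ccontr)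
      assume "\<not> y < \<alpha>' j"
      then have le: "\<alpha>' j \<le> y" by simp
      then have "pos j (\<alpha>' j) \<le> pos j y"
        using y realization_mono[OF R, of "\<alpha>' j" y j] by (auto simp: order.order_iff_strict)
      with le least[of j] y show False by auto
    qed
  qed
  show "\<alpha>' j \<le> \<alpha> j" for j
    using less_iff[of "\<alpha> j" j] by (simp add: not_less)
  show "\<alpha>' i = x"
  proof (rule antisym)
    show "\<alpha>' i \<le> x"
      using less_iff[of x i] by (simp add: not_less)
    show "x \<le> \<alpha>' i"
    proof (rule ccontr)
      assume "\<not> x \<le> \<alpha>' i"
      then have "\<alpha>' i < \<alpha> i \<and> pos i (\<alpha>' i) < pos i x"
        using x realization_mono[OF R, of "\<alpha>' i" x i] by auto
      then show False
        using less_iff by blast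
    qed
  qed
  show "finite {j. x < \<alpha>' j}"
    using realization_finite[OF R x] by (simp add: less_iff)
  show "realization (pos i x) \<alpha>' pos"
    unfolding realization_def
  proof (intro conjI allI impI)
    show "k = j" "y = z" if "y < \<alpha>' k" "z < \<alpha>' j" "pos k y = pos j z" for j k y z
      using that realization_inj[OF R] by (auto simp: less_iff)
    show "\<exists>k y. y < \<alpha>' k \<and> pos k y = \<delta>" if "\<delta> < pos i x" for \<delta>
    proof -
      have "\<delta> < \<gamma>"
        using that realization_less[OF R x] by (rule order.strict_trans)
      then obtain k y where "y < \<alpha> k" "pos k y = \<delta>"
        using realization_surj[OF R] by blast
      with that show ?thesis
        by (auto simp: less_iff)
    qed
    show "pos k y < pos k z" if "y < z" "z < \<alpha>' k" for k y z
      using that realization_mono[OF R] by (auto simp: less_iff)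
    show "finite {j. y < \<alpha>' j \<and> pos j y < pos k y}" if "y < \<alpha>' k" for k y
      by (rule finite_subset[OF _ realization_finite[OF R]]) (use that in \<open>auto simp: less_iff\<close>)
  qed (simp add: less_iff)
qed

text \<open>The strictness of \<open>step\<close> is what matters: it turns the bound
  \<open>\<delta> \<le> S \<alpha>'\<close> for each cut into \<open>\<delta> < S \<alpha>\<close>,
  and this for all \<delta> < \<gamma> bounds \<gamma>.\<close>

lemma realization_le:
  fixes S :: "('i \<Rightarrow> 'a ordinal) \<Rightarrow> 'a ordinal"
  assumes step: "\<And>\<alpha> \<alpha>' i. (\<And>j. \<alpha>' j \<le> \<alpha> j) \<Longrightarrow> \<alpha>' i < \<alpha> i \<Longrightarrow> finite {j. \<alpha>' i < \<alpha>' j} \<Longrightarrow> S \<alpha>' < S \<alpha>"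
  shows "realization \<gamma> \<alpha> pos \<Longrightarrow> \<gamma> \<le> S \<alpha>"
proof (induction \<gamma> arbitrary: \<alpha> rule: less_induct)
  case (less \<gamma>)
  have "\<delta> < S \<alpha>" if \<delta>: "\<delta> < \<gamma>" for \<delta>
  proof -
    obtain i x where x: "x < \<alpha> i" "\<delta> = pos i x"
      using realization_surj[OF less.prems \<delta>] by blast
    obtain \<alpha>' where \<alpha>': "realization \<delta> \<alpha>' pos" "\<And>j. \<alpha>' j \<le> \<alpha> j" "\<alpha>' i = x" "finite {j. x < \<alpha>' j}"
      using realization_restrict[OF less.prems x(1)] x(2) by metis
    have "\<delta> \<le> S \<alpha>'"
      by (rule less.IH[OF \<delta> \<alpha>'(1)])
    also have "\<dots> < S \<alpha>"
      using \<alpha>' x by (intro step[of _ _ i]) simp_all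
    finally show ?thesis .
  qed
  then show ?case
    using not_less by blast
qed

section \<open>Extending realizations\<close>

text \<open>Old elements keep their places, so that infinitely many extensions can be glued
  together. The length \<delta> is the same for all realizations of \<gamma>, so that lengths can be
  estimated before any realization is chosen.\<close>

definition extends ::
    "('i \<Rightarrow> 'a ordinal) \<Rightarrow> 'a ordinal \<Rightarrow> ('i \<Rightarrow> 'a ordinal) \<Rightarrow> 'a ordinal \<Rightarrow> bool" where
  "extends \<alpha> \<gamma> \<beta> \<delta> \<longleftrightarrow>
     (\<forall>i. \<alpha> i \<le> \<beta> i) \<and> \<gamma> \<le> \<delta> \<and>
     (\<forall>pos. realization \<gamma> \<alpha> pos \<longrightarrow>
        (\<exists>pos'. realization \<delta> \<beta> pos' \<and> (\<forall>i x. x < \<alpha> i \<longrightarrow> pos' i x = pos i x)))"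

lemma extends_refl: "extends \<alpha> \<gamma> \<alpha> \<gamma>"
  unfolding extends_def by blast

lemma extends_orf_mixed_sum: "extends \<alpha> \<gamma> \<beta> \<delta> \<Longrightarrow> orf_mixed_sum \<gamma> \<alpha> \<Longrightarrow> orf_mixed_sum \<delta> \<beta>"
  unfolding extends_def orf_mixed_sum_iff by blast

text \<open>The new places come last and all go to index i, so old elements get no new predecessors.
  A new element of rank \<alpha> i + z can be preceded by an element of equal rank only from an
  index longer than \<alpha> i, and \<open>fin\<close> leaves finitely many of these.\<close>

lemma extends_single:
  assumes fin: "finite {j. \<alpha> i < \<alpha> j}"
  shows "extends \<alpha> \<gamma> (\<alpha>(i := \<alpha> i + d)) (\<gamma> + d)"
  unfolding extends_def
proof (intro conjI allI impI)
  show "\<alpha> j \<le> (\<alpha>(i := \<alpha> i + d)) j" for j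
    by simp
  show "\<gamma> \<le> \<gamma> + d"
    by simp
  fix pos assume R: "realization \<gamma> \<alpha> pos"
  let ?\<beta> = "\<alpha>(i := \<alpha> i + d)"
  define pos' where "pos' j y = (if j = i \<and> \<alpha> i \<le> y then \<gamma> + osub y (\<alpha> i) else pos j y)" for j y
  have old: "pos' j y = pos j y" if "y < \<alpha> j" for j y
    using that by (auto simp: pos'_def)
  have new: "pos' i (\<alpha> i + z) = \<gamma> + z" for z
    by (simp add: pos'_def)
  have cases: thesis if "y < ?\<beta> j" "y < \<alpha> j \<Longrightarrow> thesis"
      "\<And>z. j = i \<Longrightarrow> y = \<alpha> i + z \<Longrightarrow> z < d \<Longrightarrow> thesis" for j y thesis
    using that by (auto elim!: less_add_ordinal_cases split: if_splits)
  have less: "pos' j y < \<gamma>" if "y < \<alpha> j" for j y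
    using that realization_less[OF R] by (simp add: old)
  have less_old: "y < \<alpha> j" if "y < ?\<beta> j" "pos' j y < \<gamma>" for j y
    using that(1)
  proof (rule cases)
    fix z assume "j = i" "y = \<alpha> i + z"
    with that(2) new[of z] show ?thesis
      by simp
  qed
  have "realization (\<gamma> + d) ?\<beta> pos'"
    unfolding realization_def
  proof (intro conjI allI impI)
    show "pos' j y < \<gamma> + d" if "y < ?\<beta> j" for j y
      using that
    proof (rule cases)
      show ?thesis if "y < \<alpha> j"
        using less[OF that] le_add1_ordinal less_le_trans by blast
    qed (simp add: new)
    show "j = k" "y = z" if y: "y < ?\<beta> j" and z: "z < ?\<beta> k" and eq: "pos' j y = pos' k z" for j k y z
    proof -
      have "j = k \<and> y = z"
      proof (cases "pos' j y < \<gamma>")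
        case True
        then have "y < \<alpha> j" "z < \<alpha> k"
          using less_old y z eq by simp_all
        then show ?thesis
          using eq realization_inj[OF R] by (simp add: old)
      next
        case False
        have *: "\<exists>w. j = i \<and> y = \<alpha> i + w" if "y < ?\<beta> j" "\<not> pos' j y < \<gamma>" for j y
          using that(1) by (rule cases) (use that less in auto)
        have "\<not> pos' k z < \<gamma>"
          using False eq by simp
        then obtain w where w: "k = i" "z = \<alpha> i + w"
          using *[OF z] by blast
        obtain v where v: "j = i" "y = \<alpha> i + v"
          using *[OF y False] by blast
        show ?thesis
          using eq unfolding v w new by simp
      qed
      then show "j = k" "y = z" by simp_all
    qed
    show "\<exists>j y. y < ?\<beta> j \<and> pos' j y = \<delta>" if "\<delta> < \<gamma> + d" for \<delta>
      using that
    proof (cases rule: less_add_ordinal_cases)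
      case 1
      then obtain j y where y: "y < \<alpha> j" "pos j y = \<delta>"
        using realization_surj[OF R] by blast
      then have "y < ?\<beta> j"
        by (auto intro: less_le_trans)
      with y old show ?thesis by blast
    next
      case (2 z)
      then have "\<alpha> i + z < ?\<beta> i"
        by simp
      with 2 new show ?thesis by blast
    qed
    show "pos' j y < pos' j z" if yz: "y < z" and z: "z < ?\<beta> j" for j y z
      using z
    proof (rule cases)
      show ?thesis if "z < \<alpha> j"
        using that yz realization_mono[OF R] by (simp add: old)
      fix w assume w: "j = i" "z = \<alpha> i + w"
      from yz[unfolded w(2)] show ?thesis
      proof (cases rule: less_add_ordinal_cases)
        case 1
        then have "pos' j y < \<gamma>"
          using less w by simp
        also have "\<gamma> \<le> pos' j z"
          using w by (simp add: new)
        finally show ?thesis .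
      next
        case (2 v)
        then show ?thesis
          using w by (simp add: new)
      qed
    qed
    show "finite {k. y < ?\<beta> k \<and> pos' k y < pos' j y}" if y: "y < ?\<beta> j" for j y
      using y
    proof (rule cases)
      assume y: "y < \<alpha> j"
      have "{k. y < ?\<beta> k \<and> pos' k y < pos' j y} \<subseteq> {k. y < \<alpha> k \<and> pos k y < pos j y}"
      proof
        fix k assume k: "k \<in> {k. y < ?\<beta> k \<and> pos' k y < pos' j y}"
        then have "pos' k y < \<gamma>"
          using less[OF y] by auto
        then have "y < \<alpha> k"
          using k less_old by blast
        with k y show "k \<in> {k. y < \<alpha> k \<and> pos k y < pos j y}"
          by (simp add: old)
      qed
      then show ?thesis
        using realization_finite[OF R y] finite_subset by blast
    next
      fix z assume "j = i" "y = \<alpha> i + z"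
      then have "{k. y < ?\<beta> k \<and> pos' k y < pos' j y} \<subseteq> insert i {k. \<alpha> i < \<alpha> k}"
        by (auto split: if_splits intro: le_less_trans[OF le_add1_ordinal])
      then show ?thesis
        using fin finite_subset by blast
    qed
  qed
  with old show "\<exists>pos'. realization (\<gamma> + d) ?\<beta> pos' \<and> (\<forall>i x. x < \<alpha> i \<longrightarrow> pos' i x = pos i x)"
    by blast
qed

text \<open>Places below \<open>g n\<close> are all taken at stage n, so later stages put nothing
  new before an element placed by then. Its order condition in the limit is therefore the one that
  held at stage n.\<close>

lemma extends_omega:
  fixes a :: "nat \<Rightarrow> 'i \<Rightarrow> 'a ordinal"
  assumes ext: "\<And>n. extends (a n) (g n) (a (Suc n)) (g (Suc n))"
    and b: "\<And>i. {..<b i} = (\<Union>n. {..<a n i})" and d: "{..<d} = (\<Union>n. {..<g n})"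
  shows "extends (a 0) (g 0) b d"
  unfolding extends_def
proof (intro conjI allI impI)
  have a_Suc: "a n i \<le> a (Suc n) i" for n i
    using ext[of n] unfolding extends_def by blast
  have a_le: "a n i \<le> a m i" if "n \<le> m" for n m i
    using that by (induction m rule: dec_induct) (auto intro: order.trans[OF _ a_Suc])
  have a_b: "a n i \<le> b i" for n i
    using b[of i] by (simp flip: lessThan_subset_iff) blast
  have g_d: "g n \<le> d" for n
    using d by (simp flip: lessThan_subset_iff) blast
  show "a 0 i \<le> b i" "g 0 \<le> d" for i
    by (rule a_b, rule g_d)
  fix pos assume "realization (g 0) (a 0) pos"
  \<comment> \<open>\<open>extends\<close> only asserts that a next realization exists; a coherent
    sequence has to be chosen.\<close>
  then have "\<exists>p. \<forall>n. (realization (g n) (a n) (p n) \<and> (n = 0 \<longrightarrow> p n = pos)) \<and>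
      (\<forall>i x. x < a n i \<longrightarrow> p (Suc n) i x = p n i x)"
    using ext unfolding extends_def
    by (intro dependent_nat_choice) auto
  then obtain p where R: "\<And>n. realization (g n) (a n) (p n)" and p0: "p 0 = pos"
    and pSuc: "\<And>n i x. x < a n i \<Longrightarrow> p (Suc n) i x = p n i x"
    by blast
  have p_le: "p m i x = p n i x" if "n \<le> m" "x < a n i" for n m i x
    using that(1)
  proof (induction m rule: dec_induct)
    case (step m)
    then have "x < a m i"
      using that(2) a_le[of n m i] by simp
    with step show ?case
      by (simp add: pSuc)
  qed simp
  define q where "q i x = p (LEAST n. x < a n i) i x" for i x
  have q: "q i x = p n i x" if "x < a n i" for n i x
  proof -
    have "x < a (LEAST n. x < a n i) i"
      using that by (rule LeastI)
    moreover have "(LEAST n. x < a n i) \<le> n"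
      using that by (rule Least_le)
    ultimately show ?thesis
      unfolding q_def using p_le by metis
  qed
  have lt_b: "\<exists>n. x < a n i" if "x < b i" for x i
    using b[of i] that by blast
  \<comment> \<open>At stage n the place \<open>q i x\<close> is held by some y of index j; at a
    common later stage k injectivity forces this to be x of index i.\<close>
  have below: "x < a n i" if x: "x < b i" and qx: "q i x < g n" for x i n
  proof -
    obtain m where m: "x < a m i"
      using lt_b[OF x] by blast
    obtain j y where y: "y < a n j" "p n j y = q i x"
      using realization_surj[OF R qx] by blast
    define k where "k = max m n"
    have "x < a k i" "y < a k j"
      using m y a_le[of m k i] a_le[of n k j] by (auto simp: k_def intro: less_le_trans)
    moreover from this have "p k i x = p k j y"
      using y q[of x k i] p_le[of n k y j] by (simp add: k_def)
    ultimately show ?thesis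
      using realization_inj[OF R] y by metis
  qed
  have both: "\<exists>n. x < a n i \<and> y < a n j" if x: "x < b i" and y: "y < b j" for x y i j
  proof -
    obtain m n where "x < a m i" "y < a n j"
      using lt_b[OF x] lt_b[OF y] by blast
    then show ?thesis
      using a_le[of m "max m n" i] a_le[of n "max m n" j] by (intro exI[of _ "max m n"]) auto
  qed
  have "realization d b q"
    unfolding realization_def
  proof (intro conjI allI impI)
    show "q i x < d" if "x < b i" for i x
      using lt_b[OF that] realization_less[OF R] q g_d by (metis less_le_trans)
    show "i = j" "x = y" if "x < b i" "y < b j" "q i x = q j y" for i j x y
      using both[OF that(1,2)] realization_inj[OF R] q that(3) by metis+
    show "\<exists>i x. x < b i \<and> q i x = \<delta>" if "\<delta> < d" for \<delta>
    proof -
      obtain n where "\<delta> < g n"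
        using d \<open>\<delta> < d\<close> by blast
      then obtain i x where "x < a n i" "p n i x = \<delta>"
        using realization_surj[OF R] by blast
      then show ?thesis
        using q a_b less_le_trans by metis
    qed
    show "q i x < q i y" if "x < y" "y < b i" for i x y
    proof -
      obtain n where n: "y < a n i"
        using lt_b \<open>y < b i\<close> by blast
      with \<open>x < y\<close> show ?thesis
        using q[of y n i] q[of x n i] realization_mono[OF R, of x y n i] by simp
    qed
    show "finite {j. x < b j \<and> q j x < q i x}" if x: "x < b i" for i x
    proof -
      obtain n where n: "x < a n i"
        using lt_b x by blast
      have "{j. x < b j \<and> q j x < q i x} \<subseteq> {j. x < a n j \<and> p n j x < p n i x}"
      proof
        fix j assume j: "j \<in> {j. x < b j \<and> q j x < q i x}"
        then have "q j x < g n"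
          using q[OF n] realization_less[OF R n] by auto
        then have "x < a n j"
          using j below by blast
        with j show "j \<in> {j. x < a n j \<and> p n j x < p n i x}"
          using q[OF n] q[of x n j] by simp
      qed
      then show ?thesis
        using realization_finite[OF R n] finite_subset by blast
    qed
  qed
  moreover have "\<forall>i x. x < a 0 i \<longrightarrow> q i x = pos i x"
    using q[of _ 0] p0 by simp
  ultimately show "\<exists>pos'. realization d b pos' \<and> (\<forall>i x. x < a 0 i \<longrightarrow> pos' i x = pos i x)"
    by blast
qed

section \<open>How much a countable extension gains\<close>

lemma add_mult_omega_le:
  assumes "\<And>k. x + w * fin k \<le> (d :: 'a ordinal)"
  shows "x + w * \<omega> \<le> d"
  unfolding add_le_iff_ordinal[of x "w * \<omega>"]
proof (intro conjI allI impI)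
  show "x \<le> d"
    using assms[of 0] by simp
  fix y assume "y < w * \<omega>"
  then have "\<not> w * \<omega> \<le> y"
    by simp
  then obtain k where "y < w * fin k"
    unfolding mult_omega_le_iff by (auto simp: not_le)
  then have "x + y < x + w * fin k"
    by simp
  with assms[of k] show "x + y < d"
    by (rule less_le_trans[rotated])
qed

text \<open>The length after a round depends on the length before it, so the lengths are chosen
  successively; \<omega> rounds that gain at least w each give w * \<omega>.\<close>

lemma extends_omega_growth:
  fixes a :: "nat \<Rightarrow> 'i \<Rightarrow> 'a ordinal"
  assumes step: "\<And>n g. \<exists>d. extends (a n) g (a (Suc n)) d \<and> g + w \<le> d"
    and b: "\<And>i. {..<b i} = (\<Union>n. {..<a n i})"
  obtains d where "extends (a 0) \<gamma> b d" "\<gamma> + w * \<omega> \<le> d"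
proof -
  have "\<exists>g. \<forall>n. (n = 0 \<longrightarrow> g n = \<gamma>) \<and> extends (a n) (g n) (a (Suc n)) (g (Suc n)) \<and> g n + w \<le> g (Suc n)"
    using dependent_nat_choice[of "\<lambda>n g. n = 0 \<longrightarrow> g = \<gamma>"
        "\<lambda>n g d. extends (a n) g (a (Suc n)) d \<and> g + w \<le> d"] step by auto
  then obtain g where g: "g 0 = \<gamma>" "\<And>n. extends (a n) (g n) (a (Suc n)) (g (Suc n))"
      "\<And>n. g n + w \<le> g (Suc n)"
    by blast
  obtain d where d: "{..<d} = (\<Union>n. {..<g n})"
    by (rule sup_nat_ordinal)
  have "\<gamma> + w * fin n \<le> g n" for n
  proof (induction n)
    case (Suc n)
    then have "\<gamma> + w * fin n + w \<le> g n + w"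
      by (intro add_mono_ordinal) simp_all
    then show ?case
      using g(3)[of n] by (simp add: add.assoc)
  qed (simp add: g)
  moreover have "g n \<le> d" for n
    using d by (simp flip: lessThan_subset_iff) blast
  ultimately have "\<gamma> + w * \<omega> \<le> d"
    by (meson add_mult_omega_le order.trans)
  moreover have "extends (a 0) \<gamma> b d"
    using extends_omega[of a g b d, OF g(2) b d] g(1) by simp
  ultimately show thesis
    by (rule that[rotated])
qed

text \<open>The indices are lengthened one at a time, each to its final length at once;
  \<open>g n\<close> is the length when the indices below n are done, and d is the supremum of
  these.\<close>

lemma extends_block:
  fixes a b :: "nat \<Rightarrow> 'a ordinal"
  assumes le: "\<And>j. a j \<le> b j" and fin: "\<And>j. a j < b j \<Longrightarrow> finite {k. a j < a k}"
  obtains d g where "extends a \<gamma> b d" "g 0 = \<gamma>" "\<And>n. g (Suc n) = g n + osub (b n) (a n)"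
    "\<And>n. g n \<le> d"
proof -
  define g where "g = rec_nat \<gamma> (\<lambda>n x. x + osub (b n) (a n))"
  have g0: "g 0 = \<gamma>" and gSuc: "g (Suc n) = g n + osub (b n) (a n)" for n
    by (simp_all add: g_def)
  define c where "c n j = (if j < n then b j else a j)" for n j
  have "extends (c n) (g n) (c (Suc n)) (g (Suc n))" for n
  proof (cases "a n = b n")
    case True
    then have "c (Suc n) = c n" "g (Suc n) = g n"
      using osub_add[of "b n" 0] by (auto simp: c_def gSuc less_Suc_eq)
    then show ?thesis
      by (simp add: extends_refl)
  next
    case False
    then have lt: "a n < b n"
      using le[of n] by simp
    \<comment> \<open>Only the indices below n have been lengthened so far, so they add finitely
      many to those that exceed \<open>a n\<close> from the start.\<close>
    have "{k. c n n < c n k} \<subseteq> {..<n} \<union> {k. a n < a k}"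
      by (auto simp: c_def)
    then have "finite {k. c n n < c n k}"
      using fin[OF lt] finite_subset by blast
    from extends_single[of "c n" n, OF this, of "g n" "osub (b n) (a n)"]
    have "extends (c n) (g n) ((c n)(n := a n + osub (b n) (a n))) (g (Suc n))"
      by (simp add: gSuc c_def)
    also have "(c n)(n := a n + osub (b n) (a n)) = c (Suc n)"
      using le[of n] by (auto simp: c_def less_Suc_eq)
    finally show ?thesis .
  qed
  moreover have "{..<b i} = (\<Union>n. {..<c n i})" for i
  proof -
    have "c n i \<le> b i" for n
      using le[of i] by (simp add: c_def)
    moreover have "c (Suc i) i = b i"
      by (simp add: c_def)
    ultimately show ?thesis
      by (auto intro: less_le_trans) (metis)
  qed
  moreover obtain d where d: "{..<d} = (\<Union>n. {..<g n})"
    by (rule sup_nat_ordinal)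
  ultimately have "extends (c 0) (g 0) b d"
    by (rule extends_omega)
  moreover have "c 0 = a"
    by (simp add: c_def fun_eq_iff)
  moreover have "g n \<le> d" for n
    using d by (simp flip: lessThan_subset_iff) blast
  ultimately show thesis
    using that[of d g] g0 gSuc by simp
qed

text \<open>The gain of one suitable index alone already passes \<gamma> + y. This serves where the
  gains approach z without attaining it.\<close>

lemma extends_block_sup:
  fixes a b :: "nat \<Rightarrow> 'a ordinal"
  assumes le: "\<And>j. a j \<le> b j" and fin: "\<And>j. a j < b j \<Longrightarrow> finite {k. a j < a k}"
    and z: "\<And>y. y < z \<Longrightarrow> \<exists>n. y < osub (b n) (a n)"
  obtains d where "extends a \<gamma> b d" "\<gamma> + z \<le> d"
proof -
  obtain d g where ext: "extends a \<gamma> b d" and g: "g 0 = \<gamma>" "\<And>n. g (Suc n) = g n + osub (b n) (a n)"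
    and d: "\<And>n. g n \<le> d"
    using extends_block[OF le fin] by metis
  have \<gamma>: "\<gamma> \<le> g n" for n
    by (induction n) (auto simp: g intro: order.trans)
  have "\<gamma> + y < d" if y: "y < z" for y
  proof -
    obtain n where "y < osub (b n) (a n)"
      using z y by blast
    then have "\<gamma> + y < \<gamma> + osub (b n) (a n)"
      by simp
    also have "\<dots> \<le> g (Suc n)"
      by (simp add: g add_mono_ordinal \<gamma>)
    finally show ?thesis
      using d[of "Suc n"] by simp
  qed
  then have "\<gamma> + z \<le> d"
    unfolding add_le_iff_ordinal[of \<gamma> z] using d[of 0] g by simp
  with ext show thesis
    by (rule that)
qed

text \<open>Any k of the indices that gain w account for w * k, since the length never drops in
  between.\<close>

lemma extends_block_infinite:
  fixes a b :: "nat \<Rightarrow> 'a ordinal"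
  assumes le: "\<And>j. a j \<le> b j" and fin: "\<And>j. a j < b j \<Longrightarrow> finite {k. a j < a k}"
    and inf: "infinite {n. w \<le> osub (b n) (a n)}"
  obtains d where "extends a \<gamma> b d" "\<gamma> + w * \<omega> \<le> d"
proof -
  obtain d g where ext: "extends a \<gamma> b d" and g: "g 0 = \<gamma>" "\<And>n. g (Suc n) = g n + osub (b n) (a n)"
    and d: "\<And>n. g n \<le> d"
    using extends_block[OF le fin] by metis
  have mono: "g m \<le> g n" if "m \<le> n" for m n
    using that by (induction n rule: dec_induct) (auto simp: g intro: order.trans[OF _ le_add1_ordinal])
  have "\<exists>n. \<gamma> + w * fin k \<le> g n" for k
  proof (induction k)
    case 0
    then show ?case
      by (intro exI[of _ 0]) (simp add: g)
  next
    case (Suc k)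
    then obtain n where n: "\<gamma> + w * fin k \<le> g n" ..
    obtain m where m: "n \<le> m" "w \<le> osub (b m) (a m)"
      using inf unfolding infinite_nat_iff_unbounded_le by blast
    have "\<gamma> + w * fin k + w \<le> g m + osub (b m) (a m)"
      using n mono[OF m(1)] m(2) by (intro add_mono_ordinal) auto
    then show ?case
      by (intro exI[of _ "Suc m"]) (simp add: g add.assoc)
  qed
  then have "\<gamma> + w * \<omega> \<le> d"
    by (meson add_mult_omega_le d order.trans)
  with ext show thesis
    by (rule that)
qed

section \<open>The infinitary sum on normal forms\<close>

lemma finite_zeta_seq_less: "finite {i. zeta_seq \<alpha> < \<alpha> i}"
proof -
  obtain z where "\<forall>i. \<alpha> i < z"
    using ex_greater_nat by blast
  then have "{i. z < \<alpha> i} = {}"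
    by (auto dest: less_asym)
  then have "finite {i. z < \<alpha> i}"
    by simp
  then show ?thesis
    unfolding zeta_seq_def by (rule LeastI)
qed

lemma zeta_seq_le: "finite {i. z < \<alpha> i} \<Longrightarrow> zeta_seq \<alpha> \<le> z"
  unfolding zeta_seq_def by (rule Least_le)

lemma infinite_less_zeta_seq: "d < zeta_seq \<alpha> \<Longrightarrow> infinite {i. d < \<alpha> i}"
  using zeta_seq_le[of d \<alpha>] by auto

lemma zeta_seq_eqI:
  assumes "finite {i. z < \<alpha> i}" "\<And>d. d < z \<Longrightarrow> infinite {i. d < \<alpha> i}"
  shows "zeta_seq \<alpha> = z"
proof (rule antisym)
  show "z \<le> zeta_seq \<alpha>"
    using assms(2) finite_zeta_seq_less not_less by blast
qed (rule zeta_seq_le[OF assms(1)])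

text \<open>Altering one term affects neither \<zeta> nor the number of terms reaching it being
  finite, so a single term can be shortened without changing the case of the sum.\<close>

lemma finite_Collect_upd_iff:
  "finite {j. P ((\<alpha>(i := x)) j)} \<longleftrightarrow> finite {j. P (\<alpha> j)}"
proof -
  have "{j. P ((\<alpha>(i := x)) j)} \<subseteq> insert i {j. P (\<alpha> j)}" "{j. P (\<alpha> j)} \<subseteq> insert i {j. P ((\<alpha>(i := x)) j)}"
    by (auto split: if_splits)
  then show ?thesis
    by (meson finite_insert finite_subset)
qed

lemma zeta_seq_upd [simp]: "zeta_seq (\<alpha>(i := x)) = zeta_seq \<alpha>"
  unfolding zeta_seq_def by (simp only: finite_Collect_upd_iff)

text \<open>\<open>eps_seq\<close> is \<zeta> or its successor, according to whether finitely or
  infinitely many terms reach \<zeta>.\<close>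

lemma e_special_eq:
  "e_special \<alpha> = (if finite {i. zeta_seq \<alpha> \<le> \<alpha> i} then {i. zeta_seq \<alpha> \<le> \<alpha> i} else {i. zeta_seq \<alpha> < \<alpha> i})"
proof (cases "finite {i. zeta_seq \<alpha> \<le> \<alpha> i}")
  case True
  have "eps_seq \<alpha> = zeta_seq \<alpha>"
    unfolding eps_seq_def
  proof (rule Least_equality)
    fix y assume "finite {i. y \<le> \<alpha> i}"
    then have "finite {i. y < \<alpha> i}"
      by (rule finite_subset[rotated]) auto
    then show "zeta_seq \<alpha> \<le> y"
      by (rule zeta_seq_le)
  qed (rule True)
  with True show ?thesis
    by (simp add: e_special_def)
next
  case False
  have "eps_seq \<alpha> = succ_ordinal (zeta_seq \<alpha>)"
    unfolding eps_seq_def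
  proof (rule Least_equality)
    show "finite {i. succ_ordinal (zeta_seq \<alpha>) \<le> \<alpha> i}"
      by (simp add: finite_zeta_seq_less)
    fix y assume y: "finite {i. y \<le> \<alpha> i}"
    have "zeta_seq \<alpha> < y"
    proof (rule ccontr)
      assume "\<not> zeta_seq \<alpha> < y"
      then have "{i. zeta_seq \<alpha> \<le> \<alpha> i} \<subseteq> {i. y \<le> \<alpha> i}"
        by auto
      with y False show False
        using finite_subset by blast
    qed
    then show "succ_ordinal (zeta_seq \<alpha>) \<le> y"
      by simp
  qed
  with False show ?thesis
    by (simp add: e_special_def)
qed

abbreviation S1_case :: "(nat \<Rightarrow> 'a ordinal) \<Rightarrow> bool" where
  "S1_case \<alpha> \<equiv> zeta_seq \<alpha> \<noteq> 0 \<and> limit_ordinal (last_exp (zeta_seq \<alpha>)) \<and>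
     finite {i. zeta_seq \<alpha> \<le> \<alpha> i}"

text \<open>The exponents of the (S2) formula with \<zeta> as a parameter. An index with
  \<open>\<alpha> i = z\<close> may be e-special, but its heart is 0, so it can be left out.\<close>

definition S2_cnf :: "'a ordinal \<Rightarrow> (nat \<Rightarrow> 'a ordinal) \<Rightarrow> 'a ordinal multiset" where
  "S2_cnf z \<alpha> = image_mset succ_ordinal (cnf z) + (\<Sum>i | z < \<alpha> i. cnf (osub (\<alpha> i) z))"

text \<open>Truncated differences vanish outside the original index set. Enlarging it makes it
  possible to compare two sequences over one set F.\<close>

lemma S2_cnf_eq:
  assumes "finite F" "{i. z < \<alpha> i} \<subseteq> F"
  shows "S2_cnf z \<alpha> = image_mset succ_ordinal (cnf z) + (\<Sum>i\<in>F. cnf (osub (\<alpha> i) z))"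
proof -
  have "osub (\<alpha> i) z = 0" if "\<not> z < \<alpha> i" for i
    using that osub_le_iff[of "\<alpha> i" z 0] by simp
  then have "(\<Sum>i | z < \<alpha> i. cnf (osub (\<alpha> i) z)) = (\<Sum>i\<in>F. cnf (osub (\<alpha> i) z))"
    using assms by (intro sum.mono_neutral_left) auto
  then show ?thesis
    by (simp add: S2_cnf_def)
qed

lemma the_add_eq_osub: "x \<le> w \<Longrightarrow> (THE d. x + d = w) = osub w x"
  by (simp add: osub_def max_absorb2)

lemma cnf_nat_sum_S1:
  assumes S1: "S1_case \<alpha>"
  shows "cnf (nat_sum_S \<alpha>) = image_mset succ_ordinal (cnf (hat (zeta_seq \<alpha>))) +
    {#last_exp (zeta_seq \<alpha>)#} + (\<Sum>i | zeta_seq \<alpha> \<le> \<alpha> i. cnf (osub (\<alpha> i) (hat (zeta_seq \<alpha>))))"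
proof -
  have "hat (zeta_seq \<alpha>) \<le> zeta_seq \<alpha>"
    using S1 hat_less less_imp_le by blast
  then have "diamond \<alpha> i = osub (\<alpha> i) (hat (zeta_seq \<alpha>))" if "zeta_seq \<alpha> \<le> \<alpha> i" for i
    unfolding diamond_def using that by (intro the_add_eq_osub) (rule order.trans)
  then have "(\<Sum>i | zeta_seq \<alpha> \<le> \<alpha> i. cnf (diamond \<alpha> i)) =
      (\<Sum>i | zeta_seq \<alpha> \<le> \<alpha> i. cnf (osub (\<alpha> i) (hat (zeta_seq \<alpha>))))"
    by (intro sum.cong) auto
  then show ?thesis
    using S1 by (simp add: nat_sum_S_def Let_def e_special_eq zero_less_ordinal_iff
        nat_sum_list_sorted_list cnf_nat_prod_omega)
qed

lemma cnf_nat_sum_S2: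
  assumes S2: "\<not> S1_case \<alpha>"
  shows "cnf (nat_sum_S \<alpha>) = S2_cnf (zeta_seq \<alpha>) \<alpha>"
proof -
  let ?E = "e_special \<alpha>"
  have E: "finite ?E" "{i. zeta_seq \<alpha> < \<alpha> i} \<subseteq> ?E" "?E \<subseteq> {i. zeta_seq \<alpha> \<le> \<alpha> i}"
    by (auto simp: e_special_eq finite_zeta_seq_less)
  have "heart \<alpha> i = osub (\<alpha> i) (zeta_seq \<alpha>)" if "i \<in> ?E" for i
    unfolding heart_def using that E(3) by (intro the_add_eq_osub) blast
  then have "cnf (nat_sum_S \<alpha>) =
      image_mset succ_ordinal (cnf (zeta_seq \<alpha>)) + (\<Sum>i\<in>?E. cnf (osub (\<alpha> i) (zeta_seq \<alpha>)))"
    using S2 E(1) by (auto simp: nat_sum_S_def Let_def zero_less_ordinal_iff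
        nat_sum_list_sorted_list cnf_nat_prod_omega cong: sum.cong)
  then show ?thesis
    using S2_cnf_eq[OF E(1,2)] by simp
qed

text \<open>In case (S1) each of the finitely many diamonds is at most the difference to \<zeta>
  plus one omega^e. With the separate omega^e these are finitely many copies, where the (S2) formula
  has an omega^(e+1). So a shortened sequence can mostly be treated as if it were in case
  (S2).\<close>

lemma cnf_nat_sum_S_le: "cnf (nat_sum_S \<alpha>) \<le> S2_cnf (zeta_seq \<alpha>) \<alpha>"
proof (cases "S1_case \<alpha>")
  case True
  define z h e F where "z = zeta_seq \<alpha>" and "h = hat z" and "e = last_exp z"
    and "F = {i. z \<le> \<alpha> i}"
  have z: "z \<noteq> 0" "h + omega_power e = z" and F: "finite F"
    using True hat_add_last_exp by (auto simp: z_def h_def e_def F_def)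
  have le: "cnf (osub (\<alpha> i) h) \<le> {#e#} + cnf (osub (\<alpha> i) z)" if "i \<in> F" for i
  proof -
    have "h + (omega_power e + osub (\<alpha> i) z) = \<alpha> i"
      using that z by (simp add: F_def flip: add.assoc)
    then have "osub (\<alpha> i) h = omega_power e + osub (\<alpha> i) z"
      by (rule osub_eqI)
    then show ?thesis
      using cnf_add_le_nat_sum[of "omega_power e" "osub (\<alpha> i) z"] by simp
  qed
  have "cnf (nat_sum_S \<alpha>) = image_mset succ_ordinal (cnf h) + {#e#} + (\<Sum>i\<in>F. cnf (osub (\<alpha> i) h))"
    using cnf_nat_sum_S1[OF True] by (simp add: z_def h_def e_def F_def)
  also have "\<dots> \<le> image_mset succ_ordinal (cnf h) + {#e#} + (\<Sum>i\<in>F. {#e#} + cnf (osub (\<alpha> i) z))"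
    by (intro add_left_mono sum_mono le)
  also have "\<dots> = image_mset succ_ordinal (cnf h) +
      (({#e#} + (\<Sum>i\<in>F. {#e#})) + (\<Sum>i\<in>F. cnf (osub (\<alpha> i) z)))"
    by (simp only: sum.distrib ac_simps)
  also have "\<dots> \<le> image_mset succ_ordinal (cnf h) +
      ({#succ_ordinal e#} + (\<Sum>i\<in>F. cnf (osub (\<alpha> i) z)))"
  proof (intro add_left_mono add_right_mono less_imp_le)
    show "{#e#} + (\<Sum>i\<in>F. {#e#}) < {#succ_ordinal e#}"
      using F by (simp add: set_mset_sum)
  qed
  also have "\<dots> = S2_cnf z \<alpha>"
    using F z(1) cnf_eq_add_last_exp[of z]
    by (subst S2_cnf_eq[OF F]) (auto simp: F_def h_def e_def)
  finally show ?thesis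
    by (simp add: z_def)
qed (simp add: cnf_nat_sum_S2)

text \<open>Let m be the leading exponent of z - z'. The exponents of z' from m upwards survive in
  z; those below m have successors at most m, so together with X they are dominated by the exponent
  m + 1 that z contributes.\<close>

lemma image_succ_cnf_less:
  assumes "z' < z" and X: "\<And>x. x \<in># X \<Longrightarrow> x \<le> Max (set_mset (cnf (osub z z')))"
  shows "image_mset succ_ordinal (cnf z') + X < image_mset succ_ordinal (cnf z)"
proof -
  define r m where "r = osub z z'" and "m = Max (set_mset (cnf r))"
  have r: "r \<noteq> 0" "z = z' + r"
    using assms(1) less_osub_iff[of 0 z z'] by (auto simp: r_def)
  have m: "m \<in># cnf r"
    using r by (auto simp: m_def intro: Max_in)
  let ?P = "filter_mset ((\<le>) m) (cnf z')" and ?Q = "filter_mset (\<lambda>e. \<not> m \<le> e) (cnf z')"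
  have z: "cnf z = ?P + cnf r"
    unfolding r(2) m_def by (rule cnf_add[OF r(1)])
  have z': "cnf z' = ?P + ?Q"
    by simp
  have "image_mset succ_ordinal ?Q + X < image_mset succ_ordinal (cnf r)"
  proof (rule ex_gt_imp_less_multiset, intro exI conjI allI impI)
    show "succ_ordinal m \<in># image_mset succ_ordinal (cnf r)"
      using m by simp
    fix x assume "x \<in># image_mset succ_ordinal ?Q + X"
    then show "x < succ_ordinal m"
      using X by (auto simp: r_def m_def)
  qed
  then show ?thesis
    by (subst z', subst z) (simp only: image_mset_union add.assoc add_less_cancel_left)
qed


text \<open>By \<open>fin\<close>, \<alpha>' i is at least the \<zeta> of \<alpha>', so if \<zeta>
  stays the same, the loss at i shows in the sum. Otherwise the drop of \<zeta> outweighs the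
  finitely many other changes.\<close>

lemma nat_sum_S_strict_mono:
  fixes \<alpha> \<alpha>' :: "nat \<Rightarrow> 'a ordinal"
  assumes le: "\<And>j. \<alpha>' j \<le> \<alpha> j" and less: "\<alpha>' i < \<alpha> i" and fin: "finite {j. \<alpha>' i < \<alpha>' j}"
  shows "nat_sum_S \<alpha>' < nat_sum_S \<alpha>"
proof -
  define z z' where "z = zeta_seq \<alpha>" and "z' = zeta_seq \<alpha>'"
  have fin_z: "finite {j. z < \<alpha> j}" and fin_z': "finite {j. z' < \<alpha>' j}"
    by (simp_all add: z_def z'_def finite_zeta_seq_less)
  have z'_i: "z' \<le> \<alpha>' i"
    unfolding z'_def by (rule zeta_seq_le[OF fin])
  have "finite {j. z < \<alpha>' j}"
    by (rule finite_subset[OF _ fin_z]) (use le in \<open>auto intro: less_le_trans\<close>)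
  then have "z' \<le> z"
    unfolding z'_def by (rule zeta_seq_le)
  have bound: "cnf (nat_sum_S \<alpha>') \<le> S2_cnf z' \<alpha>'"
    unfolding z'_def by (rule cnf_nat_sum_S_le)
  have osub_mono: "osub (\<alpha>' j) x \<le> osub (\<alpha> j) x" for j x
    unfolding osub_le_iff add_osub_max using le[of j] by (simp add: le_max_iff_disj)
  have osub_less: "osub (\<alpha>' i) x < osub (\<alpha> i) x" if "x \<le> \<alpha>' i" for x
    unfolding less_osub_iff using that less by simp
  have "cnf (nat_sum_S \<alpha>') < cnf (nat_sum_S \<alpha>)"
  proof (cases "S1_case \<alpha>")
    case S2: False
    then have S: "cnf (nat_sum_S \<alpha>) = S2_cnf z \<alpha>"
      unfolding z_def by (rule cnf_nat_sum_S2)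
    define F where "F = {j. z' < \<alpha>' j} \<union> {j. z < \<alpha> j}"
    have F: "finite F"
      using fin_z fin_z' by (simp add: F_def)
    have S'_eq: "S2_cnf z' \<alpha>' = image_mset succ_ordinal (cnf z') + (\<Sum>j\<in>F. cnf (osub (\<alpha>' j) z'))"
      by (rule S2_cnf_eq[OF F]) (auto simp: F_def)
    have S_eq: "S2_cnf z \<alpha> = image_mset succ_ordinal (cnf z) + (\<Sum>j\<in>F. cnf (osub (\<alpha> j) z))"
      by (rule S2_cnf_eq[OF F]) (auto simp: F_def)
    show ?thesis
    proof (cases "z' = z")
      case True
      then have "i \<in> F"
        using z'_i less by (auto simp: F_def)
      then have "(\<Sum>j\<in>F. cnf (osub (\<alpha>' j) z)) < (\<Sum>j\<in>F. cnf (osub (\<alpha> j) z))"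
        using F osub_mono osub_less z'_i True by (intro sum_strict_mono_ex1) auto
      then have "S2_cnf z' \<alpha>' < S2_cnf z \<alpha>"
        unfolding S'_eq S_eq by (simp add: True)
      with bound show ?thesis
        unfolding S by (rule le_less_trans)
    next
      case False
      with \<open>z' \<le> z\<close> have "z' < z" by simp
      \<comment> \<open>Measured from z' instead of z, each difference grows by at most r, and
        finitely many copies of r are outweighed by the step from z' to z.\<close>
      define r where "r = osub z z'"
      have summand: "cnf (osub (\<alpha>' j) z') \<le> cnf r + cnf (osub (\<alpha> j) z)" for j
      proof -
        have "z' + (r + osub (\<alpha> j) z) = max z (\<alpha> j)"
          using \<open>z' \<le> z\<close> by (simp add: r_def add_osub_max flip: add.assoc)
        then have "osub (\<alpha>' j) z' \<le> r + osub (\<alpha> j) z"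
          unfolding osub_le_iff using le[of j] by (simp add: le_max_iff_disj)
        then show ?thesis
          using cnf_add_le_nat_sum[of r "osub (\<alpha> j) z"] by (meson cnf_le_iff order.trans)
      qed
      have "S2_cnf z' \<alpha>' \<le> image_mset succ_ordinal (cnf z') + (\<Sum>j\<in>F. cnf r + cnf (osub (\<alpha> j) z))"
        unfolding S'_eq by (intro add_left_mono sum_mono summand)
      also have "\<dots> = (image_mset succ_ordinal (cnf z') + (\<Sum>j\<in>F. cnf r)) + (\<Sum>j\<in>F. cnf (osub (\<alpha> j) z))"
        by (simp only: sum.distrib add.assoc)
      also have "\<dots> < image_mset succ_ordinal (cnf z) + (\<Sum>j\<in>F. cnf (osub (\<alpha> j) z))"
        using F by (intro add_strict_right_mono image_succ_cnf_less[OF \<open>z' < z\<close>])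
          (auto simp: set_mset_sum r_def split: if_splits)
      finally show ?thesis
        using bound unfolding S S_eq by (rule le_less_trans[rotated])
    qed
  next
    case S1: True
    define h e F where "h = hat z" and "e = last_exp z" and "F = {j. z \<le> \<alpha> j}"
    have z: "z \<noteq> 0" "h + omega_power e = z" and F: "finite F" and lim: "limit_ordinal e"
      using S1 hat_add_last_exp by (auto simp: z_def h_def e_def F_def)
    have e_h: "e \<le> d" if "d \<in># cnf h" for d
      using that last_exp_le_hat[OF z(1)] by (simp add: h_def e_def)
    have S: "cnf (nat_sum_S \<alpha>) =
        image_mset succ_ordinal (cnf h) + {#e#} + (\<Sum>j\<in>F. cnf (osub (\<alpha> j) h))"
      using cnf_nat_sum_S1[OF S1] by (simp add: z_def h_def e_def F_def)
    define F' where "F' = {j. z' < \<alpha>' j} \<union> F"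
    have F': "finite F'" "F \<subseteq> F'"
      using fin_z' F by (simp_all add: F'_def)
    have S'_eq: "S2_cnf z' \<alpha>' = image_mset succ_ordinal (cnf z') + (\<Sum>j\<in>F'. cnf (osub (\<alpha>' j) z'))"
      by (rule S2_cnf_eq[OF F'(1)]) (auto simp: F'_def)
    \<comment> \<open>In case (S1) \<zeta> contributes h \<otimes> \<omega> and a bare omega^e. If
      z' is below h, the former has to pay for the drop; if z' is between h and z, the
      latter.\<close>
    consider "z' = z" | "z' < h" | "h \<le> z'" "z' < z"
      using \<open>z' \<le> z\<close> by fastforce
    then show ?thesis
    proof cases
      case 1
      define G where "G = {j. z \<le> \<alpha>' j}"
      have G: "G \<subseteq> F" "finite G" "i \<in> G"
        using le z'_i 1 finite_subset[OF _ F, of G] by (auto simp: G_def F_def intro: order.trans)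
      have "S1_case \<alpha>'"
        using S1 1 G(2) by (simp add: z_def z'_def G_def)
      from cnf_nat_sum_S1[OF this] 1
      have "cnf (nat_sum_S \<alpha>') =
          image_mset succ_ordinal (cnf h) + {#e#} + (\<Sum>j\<in>G. cnf (osub (\<alpha>' j) h))"
        by (simp add: z'_def h_def e_def G_def)
      also have "\<dots> < image_mset succ_ordinal (cnf h) + {#e#} + (\<Sum>j\<in>G. cnf (osub (\<alpha> j) h))"
      proof (rule add_strict_left_mono)
        have "h \<le> \<alpha>' i"
          using z'_i 1 z(2) le_add1_ordinal[of h "omega_power e"] by simp
        then show "(\<Sum>j\<in>G. cnf (osub (\<alpha>' j) h)) < (\<Sum>j\<in>G. cnf (osub (\<alpha> j) h))"
          using G osub_mono osub_less by (intro sum_strict_mono_ex1) (auto intro!: bexI[of _ i])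
      qed
      also have "\<dots> \<le> cnf (nat_sum_S \<alpha>)"
        unfolding S using F G by (intro add_left_mono sum_mono2) auto
      finally show ?thesis .
    next
      case 2
      define r where "r = osub h z'"
      have r: "z' + r = h" "r \<noteq> 0"
        using 2 less_osub_iff[of 0 h z'] by (auto simp: r_def)
      have "cnf h = filter_mset (\<lambda>d. Max (set_mset (cnf r)) \<le> d) (cnf z') + cnf r"
        using cnf_add[OF r(2), of z'] r(1) by simp
      then have "Max (set_mset (cnf r)) \<in># cnf h"
        using r(2) Max_in[of "set_mset (cnf r)"] by simp
      then have e_max: "e \<le> Max (set_mset (cnf r))"
        by (rule e_h)
      \<comment> \<open>Indices outside F have no term in the sum of \<alpha>. Their lengths are
        below h + omega^e, so they may need one omega^e beyond r, which is affordable because e is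
        at most every exponent of h.\<close>
      define t where "t j = (if j \<in> F then cnf (osub (\<alpha> j) h) else {#})" for j
      have summand: "cnf (osub (\<alpha>' j) z') \<le> (cnf r + {#e#}) + t j" for j
      proof (cases "j \<in> F")
        case True
        have "z' + (r + osub (\<alpha> j) h) = max h (\<alpha> j)"
          using r by (simp add: add_osub_max flip: add.assoc)
        then have "osub (\<alpha>' j) z' \<le> r + osub (\<alpha> j) h"
          unfolding osub_le_iff using le[of j] by (simp add: le_max_iff_disj)
        then have "cnf (osub (\<alpha>' j) z') \<le> cnf r + cnf (osub (\<alpha> j) h)"
          using cnf_add_le_nat_sum[of r "osub (\<alpha> j) h"] by (meson cnf_le_iff order.trans)
        also have "\<dots> \<le> cnf r + {#e#} + cnf (osub (\<alpha> j) h)"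
          by (intro add_right_mono) (simp add: subset_eq_imp_le_multiset)
        finally show ?thesis
          using True by (simp add: t_def)
      next
        case False
        then have "\<alpha>' j < z"
          using le[of j] by (simp add: F_def)
        then have "\<alpha>' j \<le> z' + (r + omega_power e)"
          using z r by (simp flip: add.assoc)
        then have "osub (\<alpha>' j) z' \<le> r + omega_power e"
          unfolding osub_le_iff .
        then show ?thesis
          using cnf_add_le_nat_sum[of r "omega_power e"] False
          by (simp add: t_def) (meson cnf_le_iff order.trans)
      qed
      have "S2_cnf z' \<alpha>' \<le> image_mset succ_ordinal (cnf z') + (\<Sum>j\<in>F'. (cnf r + {#e#}) + t j)"
        unfolding S'_eq by (intro add_left_mono sum_mono summand)
      also have "\<dots> = (image_mset succ_ordinal (cnf z') + (\<Sum>j\<in>F'. cnf r + {#e#})) + (\<Sum>j\<in>F'. t j)"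
        by (simp only: sum.distrib add.assoc)
      also have "\<dots> < image_mset succ_ordinal (cnf h) + (\<Sum>j\<in>F'. t j)"
        using F' e_max by (intro add_strict_right_mono image_succ_cnf_less[OF 2])
          (auto simp: set_mset_sum r_def split: if_splits)
      also have "(\<Sum>j\<in>F'. t j) = (\<Sum>j\<in>F. cnf (osub (\<alpha> j) h))"
        using F' by (intro sum.mono_neutral_cong_right) (auto simp: t_def)
      also have "image_mset succ_ordinal (cnf h) + \<dots> \<le> cnf (nat_sum_S \<alpha>)"
        unfolding S by (intro add_right_mono) (simp add: subset_eq_imp_le_multiset)
      finally show ?thesis
        using bound by (rule le_less_trans[rotated])
    next
      case 3
      define s where "s = osub z' h"
      have s: "h + s = z'"
        using 3 by (simp add: s_def)
      then have s_less: "s < omega_power e"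
        using 3(2) z(2) by (metis add_less_cancel_left_ordinal)
      then have s_e: "d < e" if "d \<in># cnf s" for d
        using that by (simp add: less_omega_power_iff)
      have cnf_z': "cnf z' = cnf h + cnf s"
        unfolding s[symmetric] using e_h s_e by (intro cnf_add_concat) (meson less_imp_le order.trans)
      define t where "t j = (if j \<in> F then cnf (osub (\<alpha> j) h) else {#})" for j
      \<comment> \<open>Outside F the lengths are below h + omega^e, hence differences to z' are
        below omega^e.\<close>
      define u where "u j = (if j \<in> F then {#} else cnf (osub (\<alpha>' j) z'))" for j
      have summand: "cnf (osub (\<alpha>' j) z') \<le> u j + t j" for j
      proof (cases "j \<in> F")
        case True
        have "\<alpha> j \<le> h + osub (\<alpha> j) h"
          by (simp add: add_osub_max)
        also have "\<dots> \<le> z' + osub (\<alpha> j) h"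
          using 3 by (simp add: add_mono_ordinal)
        finally have "osub (\<alpha>' j) z' \<le> osub (\<alpha> j) h"
          unfolding osub_le_iff using le[of j] by simp
        then show ?thesis
          using True by (simp add: u_def t_def)
      qed (simp add: u_def t_def)
      have u: "d < e" if "d \<in># u j" for d j
      proof -
        have j: "j \<notin> F" "d \<in># cnf (osub (\<alpha>' j) z')"
          using that by (auto simp: u_def split: if_splits)
        then have "\<alpha>' j < h + omega_power e"
          using le[of j] z by (simp add: F_def)
        also have "\<dots> \<le> z' + omega_power e"
          using 3 by (simp add: add_mono_ordinal)
        finally have "osub (\<alpha>' j) z' < omega_power e"
          using 3 add_osub_max[of z' "\<alpha>' j"] z
          by (metis add_less_cancel_left_ordinal add_strict_left_mono_ordinal add.right_neutral max_def omega_power_pos)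
        with j show ?thesis
          by (simp add: less_omega_power_iff)
      qed
      have "S2_cnf z' \<alpha>' \<le> image_mset succ_ordinal (cnf z') + (\<Sum>j\<in>F'. u j + t j)"
        unfolding S'_eq by (intro add_left_mono sum_mono summand)
      also have "\<dots> = image_mset succ_ordinal (cnf h) +
          ((image_mset succ_ordinal (cnf s) + (\<Sum>j\<in>F'. u j)) + (\<Sum>j\<in>F'. t j))"
        by (simp only: sum.distrib add.assoc cnf_z' image_mset_union)
      also have "\<dots> < image_mset succ_ordinal (cnf h) + ({#e#} + (\<Sum>j\<in>F'. t j))"
      proof (intro add_strict_left_mono add_strict_right_mono)
        \<comment> \<open>Here the limit matters: successors of exponents below e stay below e, so
          the single omega^e dominates s \<otimes> \<omega> and all \<open>u j\<close>.\<close>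
        have "succ_ordinal d < e" if "d \<in># cnf s" for d
          using s_e[OF that] lim by (simp add: limit_ordinal_iff)
        then show "image_mset succ_ordinal (cnf s) + (\<Sum>j\<in>F'. u j) < {#e#}"
          using F' u by (auto simp: set_mset_sum)
      qed
      also have "(\<Sum>j\<in>F'. t j) = (\<Sum>j\<in>F. cnf (osub (\<alpha> j) h))"
        using F' by (intro sum.mono_neutral_cong_right) (auto simp: t_def)
      also have "image_mset succ_ordinal (cnf h) + ({#e#} + \<dots>) = cnf (nat_sum_S \<alpha>)"
        unfolding S by (simp only: add.assoc)
      finally show ?thesis
        using bound by (rule le_less_trans[rotated])
    qed
  qed
  then show ?thesis
    by simp
qed

section \<open>Realizing the sum\<close>

lemma eq_add_omega_power:
  assumes "cnf z = add_mset e (cnf z')" and "\<And>d. d \<in># cnf z' \<Longrightarrow> e \<le> d"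
  shows "z = z' + omega_power e"
proof -
  have "cnf (z' + omega_power e) = cnf z' + {#e#}"
    using assms(2) by (subst cnf_add_concat) auto
  with assms(1) show ?thesis
    by (simp flip: cnf_eq_iff)
qed

lemma omega_power_succ: "omega_power (succ_ordinal x) = omega_power x * \<omega>"
proof (rule antisym)
  show "omega_power x * \<omega> \<le> omega_power (succ_ordinal x)"
    by (simp add: mult_omega_le_omega_power)
  have base: "omega_power x \<le> omega_power x * \<omega>"
    using mult_fin_less_omega[of "omega_power x" "Suc 0"] by simp
  have "omega_power x' * \<omega> \<le> omega_power x * \<omega>" if "x' \<le> x" for x'
  proof (cases "x' < x")
    case True
    then show ?thesis
      using mult_omega_le_omega_power base by (blast intro: order.trans)
  qed (use that in auto)
  then show "omega_power (succ_ordinal x) \<le> omega_power x * \<omega>"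
    using order.trans[OF one_le_omega_power base] by (auto simp: omega_power_le_iff[of "succ_ordinal x"])
qed

definition realizable :: "'a ordinal \<Rightarrow> (nat \<Rightarrow> 'a ordinal) \<Rightarrow> bool" where
  "realizable \<gamma> \<alpha> \<longleftrightarrow> (\<exists>\<delta> \<ge> \<gamma>. orf_mixed_sum \<delta> \<alpha>)"

text \<open>The realization at hand may be longer than \<gamma> by an unknown amount, so
  \<open>ext\<close> is demanded at every length.\<close>

lemma realizable_extends:
  assumes "realizable \<gamma> \<alpha>" and ext: "\<And>\<delta>. \<exists>\<delta>'. extends \<alpha> \<delta> \<beta> \<delta>' \<and> \<delta> + x \<le> \<delta>'"
  shows "realizable (\<gamma> + x) \<beta>"
proof -
  obtain \<delta> where \<delta>: "\<gamma> \<le> \<delta>" "orf_mixed_sum \<delta> \<alpha>"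
    using assms(1) unfolding realizable_def by blast
  obtain \<delta>' where \<delta>': "extends \<alpha> \<delta> \<beta> \<delta>'" "\<delta> + x \<le> \<delta>'"
    using ext by blast
  have "\<gamma> + x \<le> \<delta>'"
    using \<delta>(1) \<delta>'(2) by (meson add_mono_ordinal order.refl order.trans)
  then show ?thesis
    using extends_orf_mixed_sum[OF \<delta>'(1) \<delta>(2)] unfolding realizable_def by blast
qed

text \<open>Appending places realizes ordinary addition. It agrees with the natural sum here because
  the appended exponent is at most all others, which is why the last term is the one to
  remove.\<close>

lemma realizable_step:
  assumes IH: "\<And>\<beta>. nat_sum_S \<beta> < nat_sum_S \<alpha> \<Longrightarrow> realizable (nat_sum_S \<beta>) \<beta>"
    and cnf: "cnf (nat_sum_S \<alpha>) = add_mset e (cnf (nat_sum_S \<beta>))"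
    and min: "\<And>d. d \<in># cnf (nat_sum_S \<beta>) \<Longrightarrow> e \<le> d"
    and ext: "\<And>\<delta>. \<exists>\<delta>'. extends \<beta> \<delta> \<alpha> \<delta>' \<and> \<delta> + omega_power e \<le> \<delta>'"
  shows "realizable (nat_sum_S \<alpha>) \<alpha>"
proof -
  have eq: "nat_sum_S \<alpha> = nat_sum_S \<beta> + omega_power e"
    using cnf min by (rule eq_add_omega_power)
  have "nat_sum_S \<beta> < nat_sum_S \<alpha>"
    using add_strict_left_mono_ordinal[of 0 "omega_power e" "nat_sum_S \<beta>"] by (simp add: eq)
  from realizable_extends[OF IH[OF this] ext] show ?thesis
    by (simp add: eq)
qed

text \<open>The case where the last term \<open>\<omega>\<^sup>e\<close> of the sum comes from a single \<open>\<alpha> i\<close>: shorten \<open>\<alpha> i\<close> by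
  \<open>\<omega>\<^sup>e\<close>. The base \<open>b\<close> is \<open>\<zeta>\<close> in case (S2) and its hat in case (S1).\<close>

lemma realizable_peel:
  fixes \<alpha> :: "nat \<Rightarrow> 'a ordinal"
  assumes IH: "\<And>\<beta>. nat_sum_S \<beta> < nat_sum_S \<alpha> \<Longrightarrow> realizable (nat_sum_S \<beta>) \<beta>"
    and F: "finite F" "i \<in> F" and D: "b + D = \<alpha> i" "D \<noteq> 0"
    and sum: "\<And>x. x = \<alpha> i \<or> x = b + hat D \<Longrightarrow>
        cnf (nat_sum_S (\<alpha>(i := x))) = C + (\<Sum>j\<in>F. cnf (osub ((\<alpha>(i := x)) j) b))"
    and min: "\<And>d. d \<in># cnf (nat_sum_S \<alpha>) \<Longrightarrow> last_exp D \<le> d"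
    and zeta: "zeta_seq \<alpha> \<le> b + hat D"
  shows "realizable (nat_sum_S \<alpha>) \<alpha>"
proof -
  define x where "x = b + hat D"
  have \<alpha>_i: "x + omega_power (last_exp D) = \<alpha> i"
    unfolding x_def D(1)[symmetric] by (simp add: add.assoc hat_add_last_exp D)
  have rest: "(\<Sum>j\<in>F. cnf (osub ((\<alpha>(i := y)) j) b)) =
      cnf (osub y b) + (\<Sum>j\<in>F - {i}. cnf (osub (\<alpha> j) b))" for y
    using F by (subst sum.remove[of F i]) (auto intro: sum.cong)
  have "cnf (nat_sum_S \<alpha>) = C + (cnf D + (\<Sum>j\<in>F - {i}. cnf (osub (\<alpha> j) b)))"
    using sum[of "\<alpha> i"] rest[of "\<alpha> i"] osub_eqI[OF D(1)] by simp
  moreover have "cnf (nat_sum_S (\<alpha>(i := x))) = C + (cnf (hat D) + (\<Sum>j\<in>F - {i}. cnf (osub (\<alpha> j) b)))"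
    using sum[of x] rest[of x] by (simp add: x_def)
  ultimately have cnf: "cnf (nat_sum_S \<alpha>) = add_mset (last_exp D) (cnf (nat_sum_S (\<alpha>(i := x))))"
    using cnf_eq_add_last_exp[OF D(2)] by simp
  show ?thesis
  proof (rule realizable_step[OF IH cnf])
    show "last_exp D \<le> d" if "d \<in># cnf (nat_sum_S (\<alpha>(i := x)))" for d
      using that by (intro min) (simp add: cnf)
    \<comment> \<open>Since x is at least \<zeta>, only finitely many terms exceed it, and the
      missing places can all be given to index i.\<close>
    have "finite {j. x < (\<alpha>(i := x)) j}"
      unfolding finite_Collect_upd_iff[of "(<) x"]
      using zeta by (intro finite_subset[OF _ finite_zeta_seq_less[of \<alpha>]]) (auto simp: x_def)
    then have "extends (\<alpha>(i := x)) \<delta> ((\<alpha>(i := x))(i := x + omega_power (last_exp D)))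
        (\<delta> + omega_power (last_exp D))" for \<delta>
      using extends_single[of "\<alpha>(i := x)" i \<delta> "omega_power (last_exp D)"] by simp
    then show "\<exists>\<delta>'. extends (\<alpha>(i := x)) \<delta> \<alpha> \<delta>' \<and> \<delta> + omega_power (last_exp D) \<le> \<delta>'" for \<delta>
      unfolding \<alpha>_i by (metis fun_upd_triv fun_upd_upd order.refl)
  qed
qed

section \<open>Capping all but finitely many terms\<close>

definition cap :: "'i set \<Rightarrow> 'a ordinal \<Rightarrow> ('i \<Rightarrow> 'a ordinal) \<Rightarrow> 'i \<Rightarrow> 'a ordinal" where
  "cap F h \<alpha> j = (if j \<in> F then \<alpha> j else min (\<alpha> j) h)"

lemma less_cap_iff: "\<forall>j \<in> F. h < \<alpha> j \<Longrightarrow> {j. h < cap F h \<alpha> j} = F"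
  by (auto simp: cap_def)

lemma cap_less:
  assumes "cap F h \<alpha> j < \<alpha> j"
  shows "j \<notin> F" "cap F h \<alpha> j = h" "h < \<alpha> j"
  using assms by (auto simp: cap_def min_def split: if_splits)

text \<open>As h < \<zeta>, infinitely many terms are cut to exactly h. So h is the new \<zeta> and
  is reached infinitely often, which means case (S2) whatever the last exponent of h is.\<close>

lemma cnf_nat_sum_S_cap:
  fixes \<alpha> :: "nat \<Rightarrow> 'a ordinal"
  assumes F: "finite F" "\<forall>j \<in> F. h < \<alpha> j" and h: "h < zeta_seq \<alpha>"
  shows "cnf (nat_sum_S (cap F h \<alpha>)) =
    image_mset succ_ordinal (cnf h) + (\<Sum>j\<in>F. cnf (osub (\<alpha> j) h))"
proof -
  have eq: "{j. h < cap F h \<alpha> j} = F"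
    by (rule less_cap_iff[OF F(2)])
  have zeta: "zeta_seq (cap F h \<alpha>) = h"
  proof (rule zeta_seq_eqI)
    fix d assume "d < h"
    then have "{j. d < \<alpha> j} \<subseteq> {j. d < cap F h \<alpha> j}"
      by (auto simp: cap_def)
    then show "infinite {j. d < cap F h \<alpha> j}"
      using infinite_less_zeta_seq[of d \<alpha>] \<open>d < h\<close> h finite_subset by fastforce
  qed (simp add: eq F)
  have "{j. h < \<alpha> j} \<subseteq> {j. h \<le> cap F h \<alpha> j}"
    by (auto simp: cap_def)
  then have "infinite {j. h \<le> cap F h \<alpha> j}"
    using infinite_less_zeta_seq[OF h] finite_subset by blast
  then have "cnf (nat_sum_S (cap F h \<alpha>)) = S2_cnf h (cap F h \<alpha>)"
    using cnf_nat_sum_S2[of "cap F h \<alpha>"] by (simp add: zeta)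
  also have "\<dots> = image_mset succ_ordinal (cnf h) + (\<Sum>j\<in>F. cnf (osub (cap F h \<alpha> j) h))"
    by (rule S2_cnf_eq[OF F(1)]) (simp add: eq)
  also have "(\<Sum>j\<in>F. cnf (osub (cap F h \<alpha> j) h)) = (\<Sum>j\<in>F. cnf (osub (\<alpha> j) h))"
    by (intro sum.cong) (simp_all add: cap_def)
  finally show ?thesis .
qed

text \<open>Successors of exponents of h exceed e, so a last exponent m < e comes from a diamond and
  is peeled off its \<alpha> i. Otherwise omega^e is a last term, and it is won by lengthening the
  indices outside F beyond h.\<close>

lemma realizable_S1:
  fixes \<alpha> :: "nat \<Rightarrow> 'a ordinal"
  assumes IH: "\<And>\<beta>. nat_sum_S \<beta> < nat_sum_S \<alpha> \<Longrightarrow> realizable (nat_sum_S \<beta>) \<beta>"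
    and S1: "S1_case \<alpha>"
  shows "realizable (nat_sum_S \<alpha>) \<alpha>"
proof -
  define z h e F where "z = zeta_seq \<alpha>" and "h = hat z" and "e = last_exp z"
    and "F = {j. z \<le> \<alpha> j}"
  have z: "z \<noteq> 0" "h + omega_power e = z" and F: "finite F"
    using S1 hat_add_last_exp by (auto simp: z_def h_def e_def F_def)
  have "h < z"
    unfolding h_def by (rule hat_less[OF z(1)])
  have e_h: "e \<le> d" if "d \<in># cnf h" for d
    using that last_exp_le_hat[OF z(1)] by (simp add: h_def e_def)
  have cnf_upd: "cnf (nat_sum_S (\<alpha>(i := x))) =
      (image_mset succ_ordinal (cnf h) + {#e#}) + (\<Sum>j\<in>F. cnf (osub ((\<alpha>(i := x)) j) h))"
    if "i \<in> F" "z \<le> x" for i x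
  proof -
    have "{j. z \<le> (\<alpha>(i := x)) j} = F"
      using that by (auto simp: F_def)
    then show ?thesis
      using cnf_nat_sum_S1[of "\<alpha>(i := x)"] S1 F by (simp add: z_def h_def e_def)
  qed
  have S: "cnf (nat_sum_S \<alpha>) =
      image_mset succ_ordinal (cnf h) + {#e#} + (\<Sum>j\<in>F. cnf (osub (\<alpha> j) h))"
    using cnf_nat_sum_S1[OF S1] by (simp add: z_def h_def e_def F_def)
  define m where "m = last_exp (nat_sum_S \<alpha>)"
  have S_ne: "nat_sum_S \<alpha> \<noteq> 0"
    unfolding cnf_eq_empty_iff[symmetric] S by simp
  have m: "m \<in># cnf (nat_sum_S \<alpha>)" "\<And>d. d \<in># cnf (nat_sum_S \<alpha>) \<Longrightarrow> m \<le> d"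
    unfolding m_def using last_exp_in_cnf[OF S_ne] last_exp_le by auto
  show ?thesis
  proof (cases "m < e")
    case True
    have "m \<notin># image_mset succ_ordinal (cnf h)"
    proof
      assume "m \<in># image_mset succ_ordinal (cnf h)"
      then obtain d where d: "d \<in># cnf h" "m = succ_ordinal d"
        by auto
      then show False
        using e_h[OF d(1)] True less_succ_ordinal[of d] by order
    qed
    with m(1) True have "m \<in># (\<Sum>j\<in>F. cnf (osub (\<alpha> j) h))"
      unfolding S by auto
    then obtain i where i: "i \<in> F" "m \<in># cnf (osub (\<alpha> i) h)"
      using F by (auto simp: set_mset_sum)
    define D where "D = osub (\<alpha> i) h"
    have D: "D \<noteq> 0" "h + D = \<alpha> i"
      using i \<open>h < z\<close> by (auto simp: D_def F_def)
    have "cnf D \<subseteq># cnf (nat_sum_S \<alpha>)"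
      unfolding S D_def using F i(1) by (simp add: sum.remove)
    then have "m \<le> last_exp D"
      using last_exp_in_cnf[OF D(1)] by (intro m(2)) (rule mset_subset_eqD)
    moreover have "last_exp D \<le> m"
      using i(2) by (intro last_exp_le) (simp add: D_def)
    ultimately have m_D: "last_exp D = m"
      by simp
    \<comment> \<open>The shortened \<alpha> i has to reach \<zeta>, so that case (S1) and F
      persist. Were \<open>hat D\<close> below omega^e, D would be too, as m < e, and \<alpha> i
      would be below \<zeta>.\<close>
    have "omega_power e \<le> hat D"
    proof (rule ccontr)
      assume "\<not> omega_power e \<le> hat D"
      then have "hat D + omega_power m < omega_power e"
        using True by (intro omega_power_indecomposable) simp_all
      then have "h + D < z"
        using hat_add_last_exp[OF D(1)] z(2) by (simp add: m_D flip: z(2))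
      with D(2) i(1) show False
        by (simp add: F_def)
    qed
    then have x: "z \<le> h + hat D"
      unfolding z(2)[symmetric] by simp
    show ?thesis
    proof (rule realizable_peel[where \<alpha> = \<alpha> and i = i and b = h, OF IH F i(1) D(2,1)])
      show "cnf (nat_sum_S (\<alpha>(i := x))) =
        (image_mset succ_ordinal (cnf h) + {#e#}) + (\<Sum>j\<in>F. cnf (osub ((\<alpha>(i := x)) j) h))"
        if "x = \<alpha> i \<or> x = h + hat D" for x
        using that x i(1) by (intro cnf_upd) (auto simp: F_def)
      show "last_exp D \<le> d" if "d \<in># cnf (nat_sum_S \<alpha>)" for d
        unfolding m_D using that by (rule m(2))
      show "zeta_seq \<alpha> \<le> h + hat D"
        using x by (simp add: z_def)
    qed
  next
    case False
    have above: "\<forall>j \<in> F. h < \<alpha> j"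
      using \<open>h < z\<close> by (auto simp: F_def)
    let ?\<beta> = "cap F h \<alpha>"
    have cap: "cnf (nat_sum_S ?\<beta>) = image_mset succ_ordinal (cnf h) + (\<Sum>j\<in>F. cnf (osub (\<alpha> j) h))"
      by (rule cnf_nat_sum_S_cap[OF F above]) (use \<open>h < z\<close> in \<open>simp add: z_def\<close>)
    have S': "cnf (nat_sum_S \<alpha>) = add_mset e (cnf (nat_sum_S ?\<beta>))"
      unfolding S cap by simp
    show ?thesis
    proof (rule realizable_step[OF IH S'])
      show "e \<le> d" if "d \<in># cnf (nat_sum_S ?\<beta>)" for d
        using m(2)[of d] that False by (simp add: S')
      fix \<delta>
      obtain \<delta>' where "extends ?\<beta> \<delta> \<alpha> \<delta>'" "\<delta> + omega_power e \<le> \<delta>'"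
      proof (rule extends_block_sup)
        show "?\<beta> j \<le> \<alpha> j" for j
          by (simp add: cap_def)
        show "finite {k. ?\<beta> j < ?\<beta> k}" if "?\<beta> j < \<alpha> j" for j
          using less_cap_iff[OF above] F cap_less(2)[OF that] by simp
        \<comment> \<open>The terms outside F come arbitrarily close to \<zeta>, though none reaches
          it.\<close>
        fix y assume "y < omega_power e"
        then have "h + y < z"
          by (simp flip: z(2))
        then have "infinite {j. h + y < \<alpha> j}"
          unfolding z_def by (rule infinite_less_zeta_seq)
        then obtain n where n: "h + y < \<alpha> n" "n \<notin> F"
          using F finite_subset[of "{j. h + y < \<alpha> j}" F] by auto
        then have "h \<le> \<alpha> n"
          using le_add1_ordinal[of h y] by order
        with n have "?\<beta> n = h"
          by (simp add: cap_def min_absorb2)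
        with n(1) show "\<exists>n. y < osub (\<alpha> n) (?\<beta> n)"
          by (intro exI[of _ n]) (simp add: less_osub_iff)
      qed
      then show "\<exists>\<delta>'. extends ?\<beta> \<delta> \<alpha> \<delta>' \<and> \<delta> + omega_power e \<le> \<delta>'"
        by blast
    qed
  qed
qed

text \<open>If only finitely many \<open>\<alpha> j\<close> reach \<open>\<zeta>\<close>, moving each of them from \<open>h\<close> to its end in one go would
  gain no more than \<open>\<omega>\<^sup>e\<close>. Here \<open>e\<close> is a successor, say of \<open>u\<close>, and all of them are moved in
  parallel, \<open>\<omega>\<^sup>u\<close> places at a time: each of the \<open>\<omega>\<close> rounds gains \<open>\<omega>\<^sup>e\<close>.\<close>

lemma extends_cap:
  fixes \<alpha> :: "nat \<Rightarrow> 'a ordinal"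
  assumes z: "zeta_seq \<alpha> = h + omega_power e" and F: "F = {j. zeta_seq \<alpha> < \<alpha> j}"
    and S2: "\<not> (limit_ordinal e \<and> finite {j. zeta_seq \<alpha> \<le> \<alpha> j})"
  shows "\<exists>\<delta>'. extends (cap F h \<alpha>) \<delta> \<alpha> \<delta>' \<and> \<delta> + omega_power (succ_ordinal e) \<le> \<delta>'"
proof -
  have finF: "finite F"
    unfolding F by (rule finite_zeta_seq_less)
  have h_less: "h < zeta_seq \<alpha>"
    unfolding z using add_strict_left_mono_ordinal[of 0 "omega_power e" h] by simp
  have le_zeta: "\<alpha> j \<le> zeta_seq \<alpha>" if "j \<notin> F" for j
    using that by (simp add: F not_less)
  have fin_cap: "finite {k. cap F p \<alpha> j < cap F p \<alpha> k}"
    if "cap F p \<alpha> j = p" for p j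
    using finF by (rule finite_subset[rotated]) (use that in \<open>auto simp: cap_def split: if_splits\<close>)
  show ?thesis
  proof (cases "finite {j. zeta_seq \<alpha> \<le> \<alpha> j}")
    case False
    have "{j. zeta_seq \<alpha> \<le> \<alpha> j} - F \<subseteq> {n. omega_power e \<le> osub (\<alpha> n) (cap F h \<alpha> n)}"
    proof
      fix n assume n: "n \<in> {j. zeta_seq \<alpha> \<le> \<alpha> j} - F"
      then have "\<alpha> n = zeta_seq \<alpha>"
        using le_zeta[of n] by auto
      moreover from this have "cap F h \<alpha> n = h"
        using n h_less by (simp add: cap_def min_absorb2)
      ultimately show "n \<in> {n. omega_power e \<le> osub (\<alpha> n) (cap F h \<alpha> n)}"
        by (simp add: z)
    qed
    then have inf: "infinite {n. omega_power e \<le> osub (\<alpha> n) (cap F h \<alpha> n)}"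
      using False finF by (meson Diff_infinite_finite finite_subset)
    obtain \<delta>' where "extends (cap F h \<alpha>) \<delta> \<alpha> \<delta>'" "\<delta> + omega_power e * \<omega> \<le> \<delta>'"
    proof (rule extends_block_infinite[OF _ _ inf])
      show "cap F h \<alpha> j \<le> \<alpha> j" for j
        by (simp add: cap_def)
      show "finite {k. cap F h \<alpha> j < cap F h \<alpha> k}" if "cap F h \<alpha> j < \<alpha> j" for j
        by (rule fin_cap[OF cap_less(2)[OF that]])
    qed
    then show ?thesis
      by (auto simp: omega_power_succ)
  next
    case True
    \<comment> \<open>0 is neither a limit nor a successor, so it is excluded separately.\<close>
    have "e \<noteq> 0"
    proof
      assume "e = 0"
      then have "zeta_seq \<alpha> = succ_ordinal h"
        by (simp add: z add_one_ordinal)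
      then have "infinite {j. zeta_seq \<alpha> \<le> \<alpha> j}"
        using infinite_less_zeta_seq[OF h_less] by simp
      with True show False
        by simp
    qed
    with True S2 obtain u where e: "e = succ_ordinal u"
      by (auto simp: limit_ordinal_def)
    define p where "p n = h + omega_power u * fin n" for n
    have p_Suc: "p (Suc n) = p n + omega_power u" for n
      by (simp add: p_def add.assoc)
    have p_less: "p n < zeta_seq \<alpha>" for n
      unfolding p_def z e by (simp add: mult_fin_less_omega_power)
    define a where "a n = cap F (p n) \<alpha>" for n
    obtain \<delta>' where "extends (a 0) \<delta> \<alpha> \<delta>'" "\<delta> + omega_power e * \<omega> \<le> \<delta>'"
    proof (rule extends_omega_growth)
      show "{..<\<alpha> i} = (\<Union>n. {..<a n i})" for i
      proof (cases "i \<in> F")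
        case True
        then show ?thesis
          by (simp add: a_def cap_def)
      next
        case False
        have "\<exists>n. x < p n" if "x < \<alpha> i" for x
        proof -
          have "x < h + omega_power e"
            using that le_zeta[OF False] z by simp
          then show ?thesis
          proof (cases rule: less_add_ordinal_cases)
            case 1
            then show ?thesis
              by (intro exI[of _ 0]) (simp add: p_def)
          next
            case (2 y)
            then obtain n where "y < omega_power u * fin n"
              unfolding e by (auto elim: less_omega_power_succE)
            with 2 show ?thesis
              by (intro exI[of _ n]) (simp add: p_def)
          qed
        qed
        with False show ?thesis
          by (auto simp: a_def cap_def)
      qed
      fix n g
      \<comment> \<open>Since \<open>p (Suc n)\<close> is below \<zeta>, infinitely many terms
        outside F exceed it, and each of them gains exactly omega^u in this round.\<close>
      have inf: "infinite {j. omega_power u \<le> osub (a (Suc n) j) (a n j)}"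
      proof -
        have "{j. p (Suc n) < \<alpha> j} - F \<subseteq> {j. omega_power u \<le> osub (a (Suc n) j) (a n j)}"
        proof
          fix j assume j: "j \<in> {j. p (Suc n) < \<alpha> j} - F"
          moreover have "p n \<le> p (Suc n)"
            by (simp add: p_Suc)
          ultimately have "a (Suc n) j = p n + omega_power u" "a n j = p n"
            by (auto simp: a_def cap_def min_absorb2 simp flip: p_Suc)
          then show "j \<in> {j. omega_power u \<le> osub (a (Suc n) j) (a n j)}"
            by simp
        qed
        then show ?thesis
          using infinite_less_zeta_seq[OF p_less[of "Suc n"]] finF
          by (meson Diff_infinite_finite finite_subset)
      qed
      obtain d where "extends (a n) g (a (Suc n)) d" "g + omega_power u * \<omega> \<le> d"
      proof (rule extends_block_infinite[OF _ _ inf])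
        have "p n \<le> p (Suc n)"
          by (simp add: p_Suc)
        then show "a n j \<le> a (Suc n) j" for j
          by (auto simp: a_def cap_def intro: min.coboundedI2)
        show "finite {k. a n j < a n k}" if "a n j < a (Suc n) j" for j
          unfolding a_def
        proof (rule fin_cap)
          show "cap F (p n) \<alpha> j = p n"
            using that by (auto simp: a_def cap_def min_def split: if_splits)
        qed
      qed
      then show "\<exists>d. extends (a n) g (a (Suc n)) d \<and> g + omega_power e \<le> d"
        by (auto simp: e omega_power_succ)
    qed
    moreover have "a 0 = cap F h \<alpha>"
      by (simp add: a_def p_def)
    ultimately show ?thesis
      by (auto simp: omega_power_succ)
  qed
qed

lemma orf_mixed_sum_zero: "orf_mixed_sum 0 (\<lambda>_. 0)"
  unfolding orf_mixed_sum_iff realization_def by simp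

text \<open>The last exponent m of the sum either occurs in some \<open>osub (\<alpha> i) z\<close>,
  which is then shortened, or it is the successor of the last exponent e of \<zeta>. In the latter
  case capping at the hat of \<zeta> costs exactly omega^m.\<close>

lemma realizable_S2:
  fixes \<alpha> :: "nat \<Rightarrow> 'a ordinal"
  assumes IH: "\<And>\<beta>. nat_sum_S \<beta> < nat_sum_S \<alpha> \<Longrightarrow> realizable (nat_sum_S \<beta>) \<beta>"
    and S2: "\<not> S1_case \<alpha>"
  shows "realizable (nat_sum_S \<alpha>) \<alpha>"
proof -
  define z F where "z = zeta_seq \<alpha>" and "F = {j. z < \<alpha> j}"
  have F: "finite F"
    by (simp add: F_def z_def finite_zeta_seq_less)
  \<comment> \<open>If x is at most z, index i no longer exceeds \<zeta>, in agreement with its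
    truncated difference 0; so the same F serves.\<close>
  have cnf_upd: "cnf (nat_sum_S (\<alpha>(i := x))) =
      image_mset succ_ordinal (cnf z) + (\<Sum>j\<in>F. cnf (osub ((\<alpha>(i := x)) j) z))"
    if "i \<in> F" for i x
  proof -
    have "\<not> S1_case (\<alpha>(i := x))"
      using S2 finite_Collect_upd_iff[of "(\<le>) z" \<alpha> i x] by (simp add: z_def del: fun_upd_apply)
    moreover have "{j. z < (\<alpha>(i := x)) j} \<subseteq> F"
      using that by (auto simp: F_def split: if_splits)
    ultimately show ?thesis
      using cnf_nat_sum_S2[of "\<alpha>(i := x)"] S2_cnf_eq[OF F, of z "\<alpha>(i := x)"]
      by (simp add: z_def)
  qed
  have S: "cnf (nat_sum_S \<alpha>) =
      image_mset succ_ordinal (cnf z) + (\<Sum>j\<in>F. cnf (osub (\<alpha> j) z))"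
    using cnf_nat_sum_S2[OF S2] by (simp add: z_def F_def S2_cnf_def)
  show ?thesis
  proof (cases "nat_sum_S \<alpha> = 0")
    case True
    have cnf_0: "image_mset succ_ordinal (cnf z) + (\<Sum>j\<in>F. cnf (osub (\<alpha> j) z)) = {#}"
      by (simp only: S[symmetric] True cnf_zero)
    then have "z = 0"
      by simp
    have "\<alpha> j = 0" for j
    proof (rule ccontr)
      assume "\<alpha> j \<noteq> 0"
      then have "j \<in> F" "osub (\<alpha> j) z \<noteq> 0"
        using \<open>z = 0\<close> less_osub_iff[of 0 "\<alpha> j" 0] by (auto simp: F_def zero_less_ordinal_iff)
      with cnf_0 sum.remove[OF F \<open>j \<in> F\<close>, of "\<lambda>j. cnf (osub (\<alpha> j) z)"] show False
        by simp
    qed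
    then have "\<alpha> = (\<lambda>_. 0)"
      by blast
    then show ?thesis
      using orf_mixed_sum_zero True unfolding realizable_def by auto
  next
    case S_ne: False
    define m where "m = last_exp (nat_sum_S \<alpha>)"
    have m: "m \<in># cnf (nat_sum_S \<alpha>)" "\<And>d. d \<in># cnf (nat_sum_S \<alpha>) \<Longrightarrow> m \<le> d"
      unfolding m_def using last_exp_in_cnf[OF S_ne] last_exp_le by auto
    have sub: "cnf (osub (\<alpha> i) z) \<subseteq># cnf (nat_sum_S \<alpha>)" if "i \<in> F" for i
      unfolding S using F that by (simp add: sum.remove)
    show ?thesis
    proof (cases "\<exists>i \<in> F. m \<in># cnf (osub (\<alpha> i) z)")
      case True
      then obtain i where i: "i \<in> F" "m \<in># cnf (osub (\<alpha> i) z)"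
        by blast
      define D where "D = osub (\<alpha> i) z"
      have D: "D \<noteq> 0" "z + D = \<alpha> i"
        using i by (auto simp: D_def F_def)
      have "m \<le> last_exp D"
        using sub[OF i(1)] last_exp_in_cnf[OF D(1)] unfolding D_def by (intro m(2)) (rule mset_subset_eqD)
      moreover have "last_exp D \<le> m"
        using i(2) by (intro last_exp_le) (simp add: D_def)
      ultimately have m_D: "last_exp D = m"
        by simp
      show ?thesis
      proof (rule realizable_peel[where \<alpha> = \<alpha> and i = i and b = z, OF IH F i(1) D(2,1)])
        show "cnf (nat_sum_S (\<alpha>(i := x))) =
          image_mset succ_ordinal (cnf z) + (\<Sum>j\<in>F. cnf (osub ((\<alpha>(i := x)) j) z))" for x
          by (rule cnf_upd[OF i(1)])
        show "last_exp D \<le> d" if "d \<in># cnf (nat_sum_S \<alpha>)" for d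
          unfolding m_D using that by (rule m(2))
        show "zeta_seq \<alpha> \<le> z + hat D"
          by (simp add: z_def)
      qed
    next
      case False
      then have "m \<in># image_mset succ_ordinal (cnf z)"
        using m(1) F unfolding S by (auto simp: set_mset_sum)
      then obtain d where d: "d \<in># cnf z" "m = succ_ordinal d"
        by auto
      then have z: "z \<noteq> 0"
        by auto
      define h e where "h = hat z" and "e = last_exp z"
      have h: "h + omega_power e = z" "h < z" and cnf_z: "cnf z = add_mset e (cnf h)"
        unfolding h_def e_def by (simp_all add: hat_add_last_exp hat_less cnf_eq_add_last_exp z)
      have "m = succ_ordinal e"
      proof (rule antisym)
        show "m \<le> succ_ordinal e"
          by (rule m(2)) (simp add: S cnf_z)
        show "succ_ordinal e \<le> m"
          using last_exp_le[OF d(1)] d(2) by (simp add: e_def)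
      qed
      have above: "\<forall>j \<in> F. h < \<alpha> j"
        using h(2) by (auto simp: F_def)
      let ?\<beta> = "cap F h \<alpha>"
      \<comment> \<open>No exponent of the difference is below m = e + 1, so the omega^e by which z
        exceeds h vanishes in front of it.\<close>
      have absorb: "osub (\<alpha> j) h = osub (\<alpha> j) z" if "j \<in> F" for j
      proof (rule osub_eqI)
        let ?D = "osub (\<alpha> j) z"
        have D: "?D \<noteq> 0" "z + ?D = \<alpha> j"
          using that less_osub_iff[of 0 "\<alpha> j" z] by (auto simp: F_def)
        then obtain n where n: "n \<in># cnf ?D"
          by fastforce
        then have "m \<le> n"
          using sub[OF that] by (intro m(2)) (rule mset_subset_eqD)
        then have "omega_power e + ?D = ?D"
          using \<open>m = succ_ordinal e\<close> by (intro cnf_add_absorb[OF n]) simp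
        with D(2) show "h + ?D = \<alpha> j"
          unfolding h(1)[symmetric] by (simp add: add.assoc)
      qed
      have "cnf (nat_sum_S ?\<beta>) = image_mset succ_ordinal (cnf h) + (\<Sum>j\<in>F. cnf (osub (\<alpha> j) h))"
        by (rule cnf_nat_sum_S_cap[OF F above]) (use h(2) in \<open>simp add: z_def\<close>)
      then have S': "cnf (nat_sum_S \<alpha>) = add_mset m (cnf (nat_sum_S ?\<beta>))"
        unfolding S by (simp add: absorb cnf_z \<open>m = succ_ordinal e\<close>)
      show ?thesis
      proof (rule realizable_step[OF IH S'])
        show "m \<le> d" if "d \<in># cnf (nat_sum_S ?\<beta>)" for d
          using that by (intro m(2)) (simp add: S')
        show "\<exists>\<delta>'. extends ?\<beta> \<delta> \<alpha> \<delta>' \<and> \<delta> + omega_power m \<le> \<delta>'" for \<delta>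
          unfolding \<open>m = succ_ordinal e\<close>
          using S2 z h(1) by (intro extends_cap) (auto simp: z_def F_def e_def)
      qed
    qed
  qed
qed

lemma realizable_nat_sum_S: "realizable (nat_sum_S \<alpha>) \<alpha>"
proof (induction "nat_sum_S \<alpha>" arbitrary: \<alpha> rule: less_induct)
  case less
  then show ?case
    using realizable_S1 realizable_S2 by blast
qed

theorem theorem4p3:
  fixes \<alpha> :: "nat \<Rightarrow> 'a ordinal"
  shows "orf_mixed_sum (nat_sum_S \<alpha>) \<alpha> \<and>
         (\<forall>\<gamma>. orf_mixed_sum \<gamma> \<alpha> \<longrightarrow> \<gamma> \<le> nat_sum_S \<alpha>)"
proof -
  have upper: "\<gamma> \<le> nat_sum_S \<alpha>" if orf: "orf_mixed_sum \<gamma> \<alpha>" for \<gamma>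
  proof -
    obtain pos where "realization \<gamma> \<alpha> pos"
      using orf unfolding orf_mixed_sum_iff by blast
    then show ?thesis
      by (rule realization_le[rotated]) (rule nat_sum_S_strict_mono)
  qed
  obtain \<gamma> where "nat_sum_S \<alpha> \<le> \<gamma>" "orf_mixed_sum \<gamma> \<alpha>"
    using realizable_nat_sum_S unfolding realizable_def by blast
  then show ?thesis
    using upper antisym by metis
qed

end
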